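(* Let $(\widehat V_n)$ and $(S_n)$ be the sequences generated by the stochastic Gauss-Newton algorithm with parameters $\alpha,\beta,\gamma$, and let $\overline S_n=\frac1n S_n$. Assume that $\alpha\in[0,1/2[$ and $\alpha+\beta<1/2$. Then $$\lim_{n\to+\infty}\widehat V_n=v^\ast\quad\text{a.s.}\qquad\text{and}\qquad \lim_{n\to+\infty}\overline S_n=G_\varepsilon(v^\ast)\quad\text{a.s.}$$
   Context: **Optimal transport setting.** Let $\mathcal{X},\mathcal{Y}$ be metric spaces, $\mu$ a probability measure on $\mathcal{X}$, and $\nu=\sum_{j=1}^J \nu_j\delta_{y_j}$ a discrete probability measure on $\mathcal{Y}$ with finite support $\{y_1,\ldots,y_J\}$ of size $J$ and positive weights $\nu_j$ summing to one; $\nu$ also denotes the vector $(\nu_1,\ldots,\nu_J)^T$, and $\min(\nu)=\min_j\nu_j$, $\max(\nu)=\max_j\nu_j$. The cost $c:\mathcal{X}\times\mathcal{Y}\to\mathbb{R}$ is lower semi-continuous with $0\le c(x,y)\le c_{\mathcal X}(x)+c_{\mathcal Y}(y)$ for all $(x,y)$, where $c_{\mathcal X},c_{\mathcal Y}$ are real-valued, $\int c_{\mathcal X}\,d\mu<\infty$ and $\int c_{\mathcal Y}\,d\nu<\infty$. For $\varepsilon>0$, $x\in\mathcal X$, $v\in\mathbb{R}^J$, $$h_\varepsilon(x,v)=\varepsilon+\varepsilon\log\Bigl(\sum_{j=1}^J \exp\Bigl(\frac{v_j-c(x,y_j)}{\varepsilon}\Bigr)\nu_j\Bigr)-\sum_{j=1}^J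 v_j\nu_j,\qquad H_\varepsilon(v)=\mathbb{E}[h_\varepsilon(X,v)],\quad X\sim\mu.$$ Explicitly $\nabla_v h_\varepsilon(x,v)=\pi(x,v)-\nu$ with $\pi_j(x,v)=\nu_j e^{(v_j-c(x,y_j))/\varepsilon}/\sum_{k}\nu_k e^{(v_k-c(x,y_k))/\varepsilon}$. Let $\boldsymbol{v}_J=J^{-1/2}(1,\ldots,1)^T$, let $\langle\boldsymbol{v}_J\rangle^\perp$ be its orthogonal complement in $\mathbb{R}^J$, and $P_J=I_J-\boldsymbol{v}_J\boldsymbol{v}_J^T$. It is assumed that $H_\varepsilon$ admits a minimizer on $\mathbb{R}^J$; $v^\ast$ denotes its unique minimizer in $\langle\boldsymbol{v}_J\rangle^\perp$. Put $G_\varepsilon(v)=\mathbb{E}[\nabla_v h_\varepsilon(X,v)\nabla_v h_\varepsilon(X,v)^T]$. **Standing assumptions.** (i) $\min\{v^TG_\varepsilon(v^\ast)v/\|v\|^2:\ v\in\langle\boldsymbol{v}_J\rangle^\perp,\ v\ne0\}>0$. (ii) $\varepsilon\le \min(\nu)/(\max(\nu)-\min(\nu))$ (no restriction if $\max(\nu)=\min(\nu)$). **Stochastic Gauss-Newton (SGN) algorithm.** Let $(X_n)_{n\ge1}$ be i.i.d. with distribution $\mu$, and fix constants $0\le\alpha<1/2$, $0<\beta<1/2$, $\gamma>0$. Let $\widehat V_0$ be a square integrable random vector with values in $\langle\boldsymbol{v}_J\rangle^\perp$, independent of $(X_n)$. With $(e_1,\ldots,e_J)$ the canonical basis of $\mathbb{R}^J$,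 $\ell_k=1+((k-1)\bmod J)$ and $Z_k=\sqrt{\nu_{\ell_k}}\,e_{\ell_k}$, define $S_0=I_J$ and, recursively, $$\widehat V_{n+1}=P_J\bigl(\widehat V_n-n^\alpha S_n^{-1}\nabla_vh_\varepsilon(X_{n+1},\widehat V_n)\bigr)\quad(n\ge0),$$ $$S_n=S_{n-1}+\nabla_vh_\varepsilon(X_n,\widehat V_{n-1})\nabla_vh_\varepsilon(X_n,\widehat V_{n-1})^T+\gamma\Bigl(1+\Bigl\lfloor\frac nJ\Bigr\rfloor\Bigr)^{-\beta}Z_nZ_n^T\quad(n\ge1).$$ (For $\alpha=0$, $n^\alpha=1$ for all $n\ge 0$.) *)

theory Defs
  imports "HOL-Probability.Probability"
begin

definition lower_semicontinuous :: "('a::topological_space \<Rightarrow> real) \<Rightarrow> bool" where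
  "lower_semicontinuous f \<longleftrightarrow> (\<forall>p. \<forall>t<f p. \<forall>\<^sub>F q in nhds p. t < f q)"

(* The discrete measure is a pmf on 'y whose support is the injective image of the finite index
   type 'j under y, so that CARD('j) plays the role of J.  This is the same measure regarded as
   a vector. *)
definition weight_vec :: "'y pmf \<Rightarrow> ('j::finite \<Rightarrow> 'y) \<Rightarrow> real ^ 'j" where
  "weight_vec \<nu> y = (\<chi> j. pmf \<nu> (y j))"

definition outer_square :: "real ^ 'j \<Rightarrow> real ^ 'j ^ 'j" where
  "outer_square u = (\<chi> i j. u $ i * u $ j)"

definition unit_dir :: "real ^ ('j::finite)" where
  "unit_dir = (\<chi> j. 1 / sqrt (real CARD('j)))"

abbreviation centered :: "(real ^ ('j::finite)) set" where
  "centered \<equiv> orthogonal_comp (span {unit_dir})"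

definition proj_mat :: "real ^ 'j ^ ('j::finite)" where
  "proj_mat = mat 1 - outer_square unit_dir"

definition h_eps ::
  "real \<Rightarrow> ('x \<Rightarrow> 'y \<Rightarrow> real) \<Rightarrow> ('j::finite \<Rightarrow> 'y) \<Rightarrow> real ^ 'j \<Rightarrow> 'x \<Rightarrow> real ^ 'j \<Rightarrow> real" where
  "h_eps \<epsilon> c y w x v =
     \<epsilon> + \<epsilon> * ln (\<Sum>j\<in>UNIV. exp ((v $ j - c x (y j)) / \<epsilon>) * w $ j) - (\<Sum>j\<in>UNIV. v $ j * w $ j)"

definition pi_eps ::
  "real \<Rightarrow> ('x \<Rightarrow> 'y \<Rightarrow> real) \<Rightarrow> ('j::finite \<Rightarrow> 'y) \<Rightarrow> real ^ 'j \<Rightarrow> 'x \<Rightarrow> real ^ 'j \<Rightarrow> real ^ 'j" where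
  "pi_eps \<epsilon> c y w x v =
     (\<chi> j. w $ j * exp ((v $ j - c x (y j)) / \<epsilon>) /
            (\<Sum>k\<in>UNIV. w $ k * exp ((v $ k - c x (y k)) / \<epsilon>)))"

definition grad_h ::
  "real \<Rightarrow> ('x \<Rightarrow> 'y \<Rightarrow> real) \<Rightarrow> ('j::finite \<Rightarrow> 'y) \<Rightarrow> real ^ 'j \<Rightarrow> 'x \<Rightarrow> real ^ 'j \<Rightarrow> real ^ 'j" where
  "grad_h \<epsilon> c y w x v = pi_eps \<epsilon> c y w x v - w"

lemma GDERIV_h_eps:
  fixes w v :: "real ^ ('j::finite)"
  assumes eps: "\<epsilon> > 0" and w: "\<And>j. w $ j > 0"
  shows "GDERIV (h_eps \<epsilon> c y w x) v :> grad_h \<epsilon> c y w x v"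
proof -
  let ?E = "\<lambda>j v. exp ((v $ j - c x (y j)) / \<epsilon>)"
  let ?S = "\<Sum>j\<in>UNIV. ?E j v * w $ j"
  have pos: "?S > 0"
    by (rule sum_pos) (auto intro: mult_pos_pos w)
  have nth: "((\<lambda>v::real^'j. v $ j) has_derivative (\<lambda>u. u $ j)) (at v)" for j
    by (rule bounded_linear_imp_has_derivative) (rule bounded_linear_vec_nth)
  have E: "((\<lambda>v::real^'j. ?E j v * w $ j) has_derivative (\<lambda>u. ?E j v * (u $ j / \<epsilon>) * w $ j)) (at v)" for j
  proof -
    have "((\<lambda>v::real^'j. (v $ j - c x (y j)) / \<epsilon>) has_derivative (\<lambda>u. u $ j / \<epsilon>)) (at v)"
      using has_derivative_mult_left[OF has_derivative_diff[OF nth[of j] has_derivative_const[of "c x (y j)"]], of "inverse \<epsilon>"]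
      by (simp add: divide_inverse)
    from has_derivative_mult_left[OF has_derivative_exp[OF this], of "w $ j"] show ?thesis
      by (simp add: mult_ac)
  qed
  have S: "((\<lambda>v::real^'j. \<Sum>j\<in>UNIV. ?E j v * w $ j) has_derivative
      (\<lambda>u. \<Sum>j\<in>UNIV. ?E j v * (u $ j / \<epsilon>) * w $ j)) (at v)"
    by (rule has_derivative_sum) (rule E)
  have L: "((\<lambda>v::real^'j. \<Sum>j\<in>UNIV. v $ j * w $ j) has_derivative
      (\<lambda>u. \<Sum>j\<in>UNIV. u $ j * w $ j)) (at v)"
    by (rule has_derivative_sum) (rule has_derivative_mult_left[OF nth])
  have "((\<lambda>v. h_eps \<epsilon> c y w x v) has_derivative
      (\<lambda>u. \<epsilon> * ((\<Sum>j\<in>UNIV. ?E j v * (u $ j / \<epsilon>) * w $ j) * inverse ?S) - (\<Sum>j\<in>UNIV. u $ j * w $ j))) (at v)"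
    unfolding h_eps_def
    using has_derivative_diff[OF has_derivative_add[OF has_derivative_const[of \<epsilon>]
        has_derivative_mult_right[OF has_derivative_ln[OF pos S]]] L] by (simp add: divide_inverse)
  moreover have "(\<lambda>u. \<epsilon> * ((\<Sum>j\<in>UNIV. ?E j v * (u $ j / \<epsilon>) * w $ j) * inverse ?S) - (\<Sum>j\<in>UNIV. u $ j * w $ j))
      = (\<lambda>u. u \<bullet> grad_h \<epsilon> c y w x v)"
  proof
    fix u :: "real^'j"
    have "\<epsilon> * ((\<Sum>j\<in>UNIV. ?E j v * (u $ j / \<epsilon>) * w $ j) * inverse ?S)
        = (\<Sum>j\<in>UNIV. u $ j * (w $ j * ?E j v / ?S))"
      unfolding sum_distrib_right sum_distrib_left
      by (rule sum.cong) (use eps in \<open>simp_all add: divide_inverse mult_ac\<close>)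
    then show "\<epsilon> * ((\<Sum>j\<in>UNIV. ?E j v * (u $ j / \<epsilon>) * w $ j) * inverse ?S) - (\<Sum>j\<in>UNIV. u $ j * w $ j)
        = u \<bullet> grad_h \<epsilon> c y w x v"
      by (simp add: grad_h_def pi_eps_def inner_vec_def right_diff_distrib sum_subtractf mult.commute[of "w $ _"])
  qed
  ultimately show ?thesis
    by (simp add: gderiv_def)
qed

definition H_eps ::
  "'x measure \<Rightarrow> real \<Rightarrow> ('x \<Rightarrow> 'y \<Rightarrow> real) \<Rightarrow> ('j::finite \<Rightarrow> 'y) \<Rightarrow> real ^ 'j \<Rightarrow> real ^ 'j \<Rightarrow> real" where
  "H_eps \<mu> \<epsilon> c y w v = (\<integral>x. h_eps \<epsilon> c y w x v \<partial>\<mu>)"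

definition G_eps ::
  "'x measure \<Rightarrow> real \<Rightarrow> ('x \<Rightarrow> 'y \<Rightarrow> real) \<Rightarrow> ('j::finite \<Rightarrow> 'y) \<Rightarrow> real ^ 'j \<Rightarrow> real ^ 'j \<Rightarrow> real ^ 'j ^ 'j" where
  "G_eps \<mu> \<epsilon> c y w v = (\<integral>x. outer_square (grad_h \<epsilon> c y w x v) \<partial>\<mu>)"

(* The smallest value of the Rayleigh quotient on the nonzero centered vectors.  If CARD('j) > 1
   the infimum is attained, by compactness of the unit sphere; if CARD('j) = 1 there is no such
   vector and the value is infinity. *)
definition min_rayleigh :: "real ^ 'j ^ ('j::finite) \<Rightarrow> ereal" where
  "min_rayleigh A = (INF v\<in>centered - {0}. ereal ((v \<bullet> (A *v v)) / (norm v)\<^sup>2))"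

definition min_weight :: "real ^ ('j::finite) \<Rightarrow> real" where
  "min_weight w = Min (range (\<lambda>j. w $ j))"

definition max_weight :: "real ^ ('j::finite) \<Rightarrow> real" where
  "max_weight w = Max (range (\<lambda>j. w $ j))"

(* The cyclic direction Z_k for k >= 1; lab numbers the indices by 1, ..., CARD('j). *)
definition Z_dir :: "(nat \<Rightarrow> 'j) \<Rightarrow> real ^ 'j \<Rightarrow> nat \<Rightarrow> real ^ ('j::finite)" where
  "Z_dir lab w k = (let j = lab (1 + (k - 1) mod CARD('j)) in sqrt (w $ j) *\<^sub>R axis j 1)"

(* The case distinction is needed because 0 powr 0 = 0. *)
definition step_pow :: "real \<Rightarrow> nat \<Rightarrow> real" where
  "step_pow \<alpha> n = (if \<alpha> = 0 then 1 else real n powr \<alpha>)"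

(* One run of the algorithm: g is the gradient (x, v) |-> grad_v h(x, v), v0 the starting point
   and xs the sample path, of which only xs 1, xs 2, ... are used. *)
fun sgn_V :: "('x \<Rightarrow> real ^ 'j \<Rightarrow> real ^ 'j) \<Rightarrow> real ^ 'j \<Rightarrow> (nat \<Rightarrow> 'j) \<Rightarrow> real \<Rightarrow> real \<Rightarrow> real \<Rightarrow>
    real ^ 'j \<Rightarrow> (nat \<Rightarrow> 'x) \<Rightarrow> nat \<Rightarrow> real ^ ('j::finite)"
and sgn_S :: "('x \<Rightarrow> real ^ 'j \<Rightarrow> real ^ 'j) \<Rightarrow> real ^ 'j \<Rightarrow> (nat \<Rightarrow> 'j) \<Rightarrow> real \<Rightarrow> real \<Rightarrow> real \<Rightarrow>
    real ^ 'j \<Rightarrow> (nat \<Rightarrow> 'x) \<Rightarrow> nat \<Rightarrow> real ^ 'j ^ ('j::finite)"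
where
  "sgn_V g w lab \<alpha> \<beta> \<gamma> v0 xs 0 = v0"
| "sgn_V g w lab \<alpha> \<beta> \<gamma> v0 xs (Suc n) =
     proj_mat *v (sgn_V g w lab \<alpha> \<beta> \<gamma> v0 xs n -
       step_pow \<alpha> n *\<^sub>R (matrix_inv (sgn_S g w lab \<alpha> \<beta> \<gamma> v0 xs n) *v
                        g (xs (Suc n)) (sgn_V g w lab \<alpha> \<beta> \<gamma> v0 xs n)))"
| "sgn_S g w lab \<alpha> \<beta> \<gamma> v0 xs 0 = mat 1"
| "sgn_S g w lab \<alpha> \<beta> \<gamma> v0 xs (Suc n) =
     sgn_S g w lab \<alpha> \<beta> \<gamma> v0 xs n
     + outer_square (g (xs (Suc n)) (sgn_V g w lab \<alpha> \<beta> \<gamma> v0 xs n))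
     + (\<gamma> * (1 + real (Suc n div CARD('j))) powr (- \<beta>)) *\<^sub>R outer_square (Z_dir lab w (Suc n))"

end

theory Submission
  imports Defs
begin

text \<open>
  The objective \<open>H\<close> is a Lyapunov function for the algorithm. It is convex, and the inequality
  \<open>H u \<le> H v + \<langle>\<nabla>H v, u - v\<rangle> + 2/\<epsilon> \<parallel>u - v\<parallel>\<^sup>2\<close> holds because log-sum-exp has bounded curvature
  (\<open>h_smooth\<close>). Insert \<open>v = V n\<close> and \<open>u = V (n + 1)\<close>. The linear term is
  \<open>- n\<^sup>\<alpha> \<langle>\<nabla>H, S\<^sub>n\<inverse> g\<rangle>\<close>, because the projection is symmetric and fixes the centered vector \<open>\<nabla>H\<close>.
  Writing \<open>g = \<nabla>H + (g - \<nabla>H)\<close> leaves three terms (\<open>descent\<close>):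

  \<^item> a drift, at most \<open>- n\<^sup>\<alpha> / \<Lambda>\<^sub>n \<cdot> \<parallel>\<nabla>H\<parallel>\<^sup>2\<close>, where \<open>\<Lambda>\<^sub>n = O(n)\<close> bounds the eigenvalues of \<open>S\<^sub>n\<close> from
    above because the gradients and the \<open>Z\<^sub>k\<close> are bounded;
  \<^item> a noise term \<open>- n\<^sup>\<alpha> \<langle>\<nabla>H, S\<^sub>n\<inverse> (g - \<nabla>H)\<rangle>\<close>, which is a martingale difference;
  \<^item> the quadratic remainder, at most a constant times \<open>n\<^bsup>2 \<alpha>\<^esup> \<parallel>S\<^sub>n\<inverse>\<parallel>\<^sup>2\<close>.

  The regularization \<open>\<gamma> (1 + \<lfloor>k/J\<rfloor>)\<^bsup>-\<beta>\<^esup> Z\<^sub>k Z\<^sub>k\<^sup>T\<close> visits every coordinate once per period, so the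
  eigenvalues of \<open>S\<^sub>n\<close> are at least of order \<open>n\<^bsup>1-\<beta>\<^esup>\<close> (\<open>S_lower\<close>). The noise is therefore
  \<open>O(n\<^bsup>\<alpha>+\<beta>-1\<^esup>)\<close> and the remainder \<open>O(n\<^bsup>2(\<alpha>+\<beta>-1)\<^esup>)\<close>. Exactly because \<open>\<alpha> + \<beta> < 1/2\<close>, the squared noise
  bounds and the remainders are summable. Square summability makes the noise series converge almost
  surely (\<open>AE_summable\<close>), and from there on the argument concerns a single sample path.
  As \<open>H\<close> is bounded below on the path, \<open>H (V n)\<close> converges and the drifts are summable
  (\<open>convergent_descent\<close>). Since \<open>\<Sum> n\<^sup>\<alpha> / \<Lambda>\<^sub>n = \<infinity>\<close>, the gradient \<open>\<nabla>H (V n)\<close> comes arbitrarily close to \<open>0\<close>.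

  Strict convexity on the centered subspace and compactness of spheres keep both
  \<open>H - H v\<^sup>*\<close> and \<open>\<parallel>\<nabla>H\<parallel>\<close> away from \<open>0\<close> outside every ball around \<open>v\<^sup>*\<close> (\<open>far_from_minimizer\<close>). A small
  gradient thus identifies the limit of \<open>H (V n)\<close> as \<open>H v\<^sup>*\<close>, and this limit forces \<open>V n \<longlonglongrightarrow> v\<^sup>*\<close>.

  For the matrices, \<open>S\<^sub>n / n\<close> is the sum of four averages: of the identity and of the regularization,
  which vanish; of the bounded martingale differences \<open>g g\<^sup>T - G (V k)\<close>, which vanishes by Kronecker's
  lemma; and of \<open>G (V k)\<close>, which tends to \<open>G v\<^sup>*\<close> by continuity of \<open>G\<close>.

  Both the objective and the algorithm see a point \<open>x\<close> only through the vector of costs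
  \<open>(c x y\<^sub>j)\<^sub>j\<close>. The proof therefore takes the sample space to be \<open>\<real>\<^sup>J\<close> with \<open>c\<close> the evaluation of
  coordinates, and transports the result back at the very end.
\<close>

section \<open>Averages and descent of real sequences\<close>

lemma cesaro_mean:
  fixes f :: "nat \<Rightarrow> 'a::real_normed_vector"
  assumes "f \<longlonglongrightarrow> l"
  shows "(\<lambda>n. (1 / real n) *\<^sub>R (\<Sum>k<n. f k)) \<longlonglongrightarrow> l"
proof (rule LIMSEQ_I)
  fix r :: real assume r: "r > 0"
  then obtain N where N: "\<And>n. n \<ge> N \<Longrightarrow> norm (f n - l) < r / 2"
    using LIMSEQ_D[OF assms, of "r/2"] by auto
  define K where "K = (\<Sum>k<N. norm (f k - l))"
  have K: "K \<ge> 0" by (auto simp: K_def sum_nonneg)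
  obtain N' :: nat where N': "real N' > 2 * K / r" using reals_Archimedean2 by blast
  show "\<exists>no. \<forall>n\<ge>no. norm ((1 / real n) *\<^sub>R (\<Sum>k<n. f k) - l) < r"
  proof (intro exI allI impI)
    fix n assume n: "n \<ge> max (Suc N') (Suc N)"
    then have n0: "real n > 0" and "n \<ge> N" by auto
    have "real n > 2 * K / r" using N' n by simp
    then have Kn: "K < real n * (r / 2)" using r n0 by (simp add: field_simps)
    have "(1 / real n) *\<^sub>R (\<Sum>k<n. f k) - l = (1 / real n) *\<^sub>R (\<Sum>k<n. f k - l)"
      using n0 by (simp add: sum_subtractf scaleR_diff_right sum_constant_scaleR)
    moreover have "norm (\<Sum>k<n. f k - l) \<le> (\<Sum>k<n. norm (f k - l))" by (rule norm_sum)
    moreover have "(\<Sum>k<n. norm (f k - l)) = K + (\<Sum>k=N..<n. norm (f k - l))"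
      unfolding K_def using \<open>n \<ge> N\<close> by (metis lessThan_atLeast0 sum.atLeastLessThan_concat zero_le)
    moreover have "(\<Sum>k=N..<n. norm (f k - l)) \<le> (\<Sum>k=N..<n. r / 2)"
      by (rule sum_mono) (use N in \<open>auto intro: less_imp_le\<close>)
    moreover have "(\<Sum>k=N..<n. r / 2) \<le> real n * (r / 2)"
      using r by (simp add: of_nat_diff \<open>n \<ge> N\<close>)
    ultimately have "norm (\<Sum>k<n. f k - l) < real n * r" using Kn by linarith
    then show "norm ((1 / real n) *\<^sub>R (\<Sum>k<n. f k) - l) < r"
      using n0 \<open>_ = (1 / real n) *\<^sub>R (\<Sum>k<n. f k - l)\<close> by (simp add: field_simps)
  qed
qed

text \<open>
  The case of Kronecker's lemma with weights \<open>k\<close>. Summation by parts turns the mean of \<open>x\<close> into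
  the difference between the partial sums of \<open>\<Sum> x\<^sub>k / (k + 1)\<close> and their own Cesaro means, and both have
  the same limit.
\<close>
lemma kronecker_mean:
  fixes x :: "nat \<Rightarrow> real"
  assumes "summable (\<lambda>k. x k / real (Suc k))"
  shows "(\<lambda>n. (\<Sum>k<n. x k) / real n) \<longlonglongrightarrow> 0"
proof -
  define s where "s n = (\<Sum>k<n. x k / real (Suc k))" for n
  have s: "s \<longlonglongrightarrow> suminf (\<lambda>k. x k / real (Suc k))"
    using summable_LIMSEQ[OF assms] by (simp add: s_def[abs_def])
  have parts: "(\<Sum>k<n. x k) = real n * s n - (\<Sum>k<n. s k)" for n
  proof (induction n)
    case (Suc n)
    have "real (Suc n) * s (Suc n) = real (Suc n) * s n + x n"
      by (simp add: s_def field_simps)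
    with Suc show ?case by (simp add: algebra_simps)
  qed (simp add: s_def)
  have "(\<lambda>n. s n - (1 / real n) *\<^sub>R (\<Sum>k<n. s k)) \<longlonglongrightarrow> 0"
    using tendsto_diff[OF s cesaro_mean[OF s]] by simp
  moreover have "\<forall>\<^sub>F n in sequentially. s n - (1 / real n) *\<^sub>R (\<Sum>k<n. s k) = (\<Sum>k<n. x k) / real n"
    using eventually_gt_at_top[of "0::nat"]
    by eventually_elim (simp add: parts field_simps)
  ultimately show ?thesis by (rule Lim_transform_eventually)
qed

text \<open>
  A deterministic counterpart of the Robbins-Siegmund theorem: \<open>h n\<close> plus all drifts accumulated so
  far, corrected by the perturbations, is decreasing and bounded below. The series
  \<open>\<Sum> D\<close> may converge conditionally, as a series of martingale differences does.
\<close>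
lemma convergent_descent:
  fixes h p D b :: "nat \<Rightarrow> real"
  assumes h: "\<And>n. 0 \<le> h n" and p: "\<And>n. 0 \<le> p n"
    and step: "\<And>n. h (Suc n) \<le> h n - p n - D n + b n"
    and D: "summable D" and b: "summable b"
  shows "convergent h" and "summable p"
proof -
  define u where "u n = h n + (\<Sum>k<n. p k + D k - b k)" for n
  have "u (Suc n) \<le> u n" for n using step[of n] by (simp add: u_def)
  then have dec: "decseq u" by (simp add: decseq_Suc_iff)
  have Db: "summable (\<lambda>k. D k - b k)" using D b by (rule summable_diff)
  then have "Bseq (\<lambda>n. \<Sum>k<n. D k - b k)"
    using convergent_imp_Bseq summable_iff_convergent by blast
  then obtain B where B: "\<And>n. \<bar>\<Sum>k<n. D k - b k\<bar> \<le> B"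
    by (auto simp: Bseq_def)
  have u_eq: "u n = h n + (\<Sum>k<n. p k) + (\<Sum>k<n. D k - b k)" for n
    by (simp add: u_def sum.distrib[symmetric] algebra_simps)
  have ps: "0 \<le> (\<Sum>k<n. p k)" for n by (simp add: sum_nonneg p)
  have "(\<Sum>k<n. p k) \<le> u 0 + B" for n
    using B[of n] u_eq[of n] h[of n] decseqD[OF dec, of 0 n] by (simp add: abs_le_iff)
  then show sp: "summable p" by (intro summableI_nonneg_bounded p)
  have "- B \<le> u n" for n using B[of n] u_eq[of n] h[of n] ps[of n] by (simp add: abs_le_iff)
  then obtain L where L: "u \<longlonglongrightarrow> L" using decseq_convergent[OF dec, of "-B"] by metis
  have "(\<lambda>n. u n - (\<Sum>k<n. p k) - (\<Sum>k<n. D k - b k)) \<longlonglongrightarrow> L - suminf p - suminf (\<lambda>k. D k - b k)"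
    by (intro tendsto_diff L summable_LIMSEQ sp Db)
  then show "convergent h" by (auto simp: u_eq convergent_def)
qed


section \<open>Series of bounded martingale differences\<close>

text \<open>
  The martingale property is stated through integrals over the sets of the past instead of
  conditional expectations; this is what independence yields directly through Fubini's theorem.
\<close>
locale bounded_martingale_differences = prob_space M
  for M :: "'a measure" +
  fixes F :: "nat \<Rightarrow> 'a measure" and D :: "nat \<Rightarrow> 'a \<Rightarrow> real" and d :: "nat \<Rightarrow> real"
  assumes subalg: "\<And>n. subalgebra M (F n)"
    and filtration: "\<And>m n. m \<le> n \<Longrightarrow> sets (F m) \<subseteq> sets (F n)"
    and adapted: "\<And>n. D n \<in> borel_measurable (F (Suc n))"
    and bounded_difference: "\<And>n \<omega>. \<omega> \<in> space M \<Longrightarrow> \<bar>D n \<omega>\<bar> \<le> d n"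
    and centered_difference: "\<And>n A. A \<in> sets (F n) \<Longrightarrow> (\<integral>\<omega>. indicator A \<omega> * D n \<omega> \<partial>M) = 0"
begin

lemma space_F: "space (F n) = space M"
  using subalg[of n] by (simp add: subalgebra_def)

lemma measurable_F_mono:
  "f \<in> borel_measurable (F m) \<Longrightarrow> m \<le> n \<Longrightarrow> f \<in> borel_measurable (F n)"
  using filtration[of m n] space_F by (auto simp: measurable_def)

lemma D_measurable_F: "k < n \<Longrightarrow> D k \<in> borel_measurable (F n)"
  using measurable_F_mono[OF adapted[of k], of n] by simp

lemma D_measurable [measurable]: "D n \<in> borel_measurable M"
  using measurable_from_subalg[OF subalg adapted] .

lemma d_nonneg: "0 \<le> d n"
  using bounded_difference[of _ n] not_empty by (meson abs_ge_zero ex_in_conv order_trans)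

lemma D_integrable: "integrable M (D n)"
  by (rule integrable_const_bound[of _ "d n"]) (auto intro: bounded_difference)

lemma orthogonal_to_past:
  assumes f: "f \<in> borel_measurable (F n)" and int: "integrable M (\<lambda>\<omega>. f \<omega> * D n \<omega>)"
  shows "(\<integral>\<omega>. f \<omega> * D n \<omega> \<partial>M) = 0"
proof -
  interpret S: finite_measure_subalgebra M "F n"
    by unfold_locales (rule subalg)
  have "AE \<omega> in M. real_cond_exp M (F n) (D n) \<omega> = 0"
    by (rule S.real_cond_exp_charact)
       (auto simp: set_lebesgue_integral_def centered_difference D_integrable)
  then have "(\<integral>\<omega>. f \<omega> * real_cond_exp M (F n) (D n) \<omega> \<partial>M) = (\<integral>\<omega>. 0 \<partial>M)"
    using measurable_from_subalg[OF subalg f]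
    by (intro integral_cong_AE) (auto intro: borel_measurable_times)
  then show ?thesis
    using S.real_cond_exp_intg(2)[OF int f D_measurable] by simp
qed

lemma partial_sum_bound:
  "\<omega> \<in> space M \<Longrightarrow> \<bar>\<Sum>k<n. D k \<omega>\<bar> \<le> (\<Sum>k<n. d k)"
  by (rule order_trans[OF sum_abs sum_mono]) (auto intro: bounded_difference)

text \<open>
  Each difference is orthogonal to the sum of its predecessors, so the second moments add up.
\<close>
lemma second_moment_partial_sum:
  "(\<integral>\<omega>. (\<Sum>k<n. D k \<omega>)\<^sup>2 \<partial>M) \<le> (\<Sum>k<n. (d k)\<^sup>2)"
proof (induction n)
  case (Suc n)
  let ?s = "\<lambda>\<omega>. \<Sum>k<n. D k \<omega>"
  have sF: "?s \<in> borel_measurable (F n)"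
    by (intro borel_measurable_sum D_measurable_F) auto
  have "(?s \<omega>)\<^sup>2 \<le> (\<Sum>k<n. d k)\<^sup>2" if "\<omega> \<in> space M" for \<omega>
    using partial_sum_bound[OF that, of n] by (simp only: abs_le_square_iff[symmetric])
  then have i1: "integrable M (\<lambda>\<omega>. (?s \<omega>)\<^sup>2)"
    by (intro integrable_const_bound[of _ "(\<Sum>k<n. d k)\<^sup>2"]) auto
  have i2: "integrable M (\<lambda>\<omega>. ?s \<omega> * D n \<omega>)"
    by (rule integrable_const_bound[of _ "(\<Sum>k<n. d k) * d n"])
       (auto intro!: mult_mono partial_sum_bound bounded_difference sum_nonneg d_nonneg simp: abs_mult)
  have b3: "(D n \<omega>)\<^sup>2 \<le> (d n)\<^sup>2" if "\<omega> \<in> space M" for \<omega>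
    using bounded_difference[OF that, of n] d_nonneg[of n] by (simp add: abs_le_square_iff[symmetric])
  have i3: "integrable M (\<lambda>\<omega>. (D n \<omega>)\<^sup>2)"
    by (rule integrable_const_bound[of _ "(d n)\<^sup>2"]) (auto intro: b3)
  have "(\<integral>\<omega>. (\<Sum>k<Suc n. D k \<omega>)\<^sup>2 \<partial>M) = (\<integral>\<omega>. (?s \<omega>)\<^sup>2 + (D n \<omega>)\<^sup>2 + 2 * (?s \<omega> * D n \<omega>) \<partial>M)"
    by (simp add: power2_sum algebra_simps)
  also have "\<dots> = (\<integral>\<omega>. (?s \<omega>)\<^sup>2 \<partial>M) + (\<integral>\<omega>. (D n \<omega>)\<^sup>2 \<partial>M) + 2 * (\<integral>\<omega>. ?s \<omega> * D n \<omega> \<partial>M)"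
    using i1 i2 i3 by simp
  also have "(\<integral>\<omega>. ?s \<omega> * D n \<omega> \<partial>M) = 0"
    by (rule orthogonal_to_past[OF sF i2])
  also have "(\<integral>\<omega>. (D n \<omega>)\<^sup>2 \<partial>M) \<le> (\<integral>\<omega>. (d n)\<^sup>2 \<partial>M)"
    by (rule integral_mono[OF i3]) (auto intro: b3)
  finally show ?case using Suc by (simp add: prob_space)
qed simp

lemma shifted: "bounded_martingale_differences M (\<lambda>n. F (m + n)) (\<lambda>n. D (m + n)) (\<lambda>n. d (m + n))"
  by unfold_locales
     (use subalg filtration adapted[of "m + _"] bounded_difference centered_difference in auto)

text \<open>
  Switching off differences by events of the past preserves the martingale property and the bounds.
  With \<open>B n\<close> the event that a threshold has not been reached by time \<open>n\<close>, this is optional stopping.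
\<close>
lemma stopped:
  assumes B: "\<And>n. B n \<in> sets (F n)"
  shows "bounded_martingale_differences M F (\<lambda>n \<omega>. indicator (B n) \<omega> * D n \<omega>) d"
proof unfold_locales
  fix n
  have "B n \<in> sets (F (Suc n))" using B[of n] filtration[of n "Suc n"] by auto
  then show "(\<lambda>\<omega>. indicator (B n) \<omega> * D n \<omega>) \<in> borel_measurable (F (Suc n))"
    using adapted[of n] by (auto intro: borel_measurable_times)
  show "\<bar>indicator (B n) \<omega> * D n \<omega>\<bar> \<le> d n" if "\<omega> \<in> space M" for \<omega>
    using bounded_difference[OF that, of n] d_nonneg[of n] by (auto simp: indicator_def)
  show "(\<integral>\<omega>. indicator A \<omega> * (indicator (B n) \<omega> * D n \<omega>) \<partial>M) = 0" if "A \<in> sets (F n)" for A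
    using centered_difference[of "A \<inter> B n" n] that B[of n]
    by (simp add: indicator_inter_arith mult.assoc)
qed (use subalg filtration in auto)

text \<open>
  Kolmogorov's inequality. The sum stopped when it first leaves \<open>(-r, r)\<close> stays frozen
  outside, so leaving the interval at any time up to \<open>n\<close> is visible in the stopped sum at time \<open>n\<close>,
  whose second moment is controlled.
\<close>
lemma maximal_inequality:
  assumes r: "r > 0"
  shows "prob {\<omega> \<in> space M. \<exists>j\<le>n. r \<le> \<bar>\<Sum>k<j. D k \<omega>\<bar>} \<le> (\<Sum>k<n. (d k)\<^sup>2) / r\<^sup>2"
proof -
  define B where "B k = {\<omega> \<in> space M. \<forall>j\<le>k. \<bar>\<Sum>i<j. D i \<omega>\<bar> < r}" for k
  have B: "B k \<in> sets (F k)" for k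
  proof -
    have "{\<omega> \<in> space (F k). \<bar>\<Sum>i<j. D i \<omega>\<bar> < r} \<in> sets (F k)" if "j \<le> k" for j
    proof -
      have [measurable]: "D i \<in> borel_measurable (F k)" if "i \<in> {..<j}" for i
        using that \<open>j \<le> k\<close> by (intro D_measurable_F) auto
      show ?thesis by measurable
    qed
    then have "(\<Inter>j\<in>{..k}. {\<omega> \<in> space (F k). \<bar>\<Sum>i<j. D i \<omega>\<bar> < r}) \<in> sets (F k)"
      by (intro sets.finite_INT) auto
    also have "(\<Inter>j\<in>{..k}. {\<omega> \<in> space (F k). \<bar>\<Sum>i<j. D i \<omega>\<bar> < r}) = B k"
      by (auto simp: B_def space_F)
    finally show ?thesis .
  qed
  define T where "T \<omega> = (\<Sum>k<n. indicator (B k) \<omega> * D k \<omega>)" for \<omega>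
  interpret T: bounded_martingale_differences M F "\<lambda>n \<omega>. indicator (B n) \<omega> * D n \<omega>" d
    by (rule stopped[OF B])
  have Tm [measurable]: "T \<in> borel_measurable M"
    unfolding T_def using T.D_measurable by (intro borel_measurable_sum)
  have "(T \<omega>)\<^sup>2 \<le> (\<Sum>k<n. d k)\<^sup>2" if "\<omega> \<in> space M" for \<omega>
    using T.partial_sum_bound[OF that, of n] unfolding T_def by (simp only: abs_le_square_iff[symmetric])
  then have iT: "integrable M (\<lambda>\<omega>. (T \<omega>)\<^sup>2)"
    by (intro integrable_const_bound[of _ "(\<Sum>k<n. d k)\<^sup>2"]) auto
  have sub: "{\<omega> \<in> space M. \<exists>j\<le>n. r \<le> \<bar>\<Sum>k<j. D k \<omega>\<bar>} \<subseteq> {\<omega> \<in> space M. r\<^sup>2 \<le> (T \<omega>)\<^sup>2}"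
  proof safe
    fix \<omega> j assume \<omega>: "\<omega> \<in> space M" and j: "j \<le> n" "r \<le> \<bar>\<Sum>k<j. D k \<omega>\<bar>"
    define \<tau> where "\<tau> = (LEAST j. r \<le> \<bar>\<Sum>k<j. D k \<omega>\<bar>)"
    have \<tau>: "r \<le> \<bar>\<Sum>k<\<tau>. D k \<omega>\<bar>" "\<tau> \<le> j"
      unfolding \<tau>_def using j(2) by (rule LeastI, rule Least_le)
    have before: "\<omega> \<in> B k \<longleftrightarrow> k < \<tau>" for k
      using \<omega> \<tau>(1) not_less_Least[of _ "\<lambda>j. r \<le> \<bar>\<Sum>k<j. D k \<omega>\<bar>"]
      by (fastforce simp: B_def \<tau>_def[symmetric] not_le)
    have "T \<omega> = (\<Sum>k<n. if k \<in> {..<\<tau>} then D k \<omega> else 0)"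
      unfolding T_def by (intro sum.cong) (simp_all add: before indicator_def)
    also have "\<dots> = (\<Sum>k\<in>{..<n} \<inter> {..<\<tau>}. D k \<omega>)"
      by (simp only: sum.inter_restrict[OF finite_lessThan])
    also have "{..<n} \<inter> {..<\<tau>} = {..<\<tau>}" using \<tau>(2) j(1) by auto
    finally show "r\<^sup>2 \<le> (T \<omega>)\<^sup>2" using \<tau>(1) r by (simp add: abs_le_square_iff[symmetric])
  qed
  have "prob {\<omega> \<in> space M. \<exists>j\<le>n. r \<le> \<bar>\<Sum>k<j. D k \<omega>\<bar>} \<le> prob {\<omega> \<in> space M. r\<^sup>2 \<le> (T \<omega>)\<^sup>2}"
    by (rule finite_measure_mono[OF sub]) measurable
  also have "\<dots> \<le> (\<integral>\<omega>. (T \<omega>)\<^sup>2 \<partial>M) / r\<^sup>2"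
    using integral_Markov_inequality_measure[OF iT, of "space M" "r\<^sup>2"] r by simp
  also have "\<dots> \<le> (\<Sum>k<n. (d k)\<^sup>2) / r\<^sup>2"
    unfolding T_def by (intro divide_right_mono T.second_moment_partial_sum) auto
  finally show ?thesis .
qed

text \<open>
  The maximal inequality for the differences from time \<open>m\<close> on bounds the probability of an
  oscillation of size \<open>r\<close> after \<open>m\<close> by a tail of \<open>\<Sum> d\<^sup>2\<close>. Letting \<open>m\<close> grow, almost every sequence of
  partial sums is Cauchy.
\<close>
theorem AE_summable:
  assumes d: "summable (\<lambda>n. (d n)\<^sup>2)"
  shows "AE \<omega> in M. summable (\<lambda>n. D n \<omega>)"
proof -
  define tail where "tail m = (\<Sum>k. (d (k + m))\<^sup>2)" for m
  have tail0: "tail \<longlonglongrightarrow> 0" unfolding tail_def by (rule suminf_exist_split2[OF d])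
  define E where "E r m = {\<omega> \<in> space M. \<exists>j. r \<le> \<bar>\<Sum>k<j. D (m + k) \<omega>\<bar>}" for r m
  have [measurable]: "E r m \<in> sets M" for r m unfolding E_def by measurable
  have E: "prob (E r m) \<le> tail m / r\<^sup>2" if r: "r > 0" for r m
  proof -
    interpret S: bounded_martingale_differences M "\<lambda>n. F (m + n)" "\<lambda>n. D (m + n)" "\<lambda>n. d (m + n)"
      by (rule shifted)
    define E' where "E' n = {\<omega> \<in> space M. \<exists>j\<le>n. r \<le> \<bar>\<Sum>k<j. D (m + k) \<omega>\<bar>}" for n
    have [measurable]: "E' n \<in> sets M" for n unfolding E'_def by measurable
    have "incseq E'" by (auto simp: E'_def incseq_def intro: order_trans)
    then have "(\<lambda>n. prob (E' n)) \<longlonglongrightarrow> prob (\<Union>n. E' n)"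
      by (intro finite_Lim_measure_incseq) auto
    also have "(\<Union>n. E' n) = E r m" by (auto simp: E'_def E_def)
    finally have lim: "(\<lambda>n. prob (E' n)) \<longlonglongrightarrow> prob (E r m)" .
    have "prob (E' n) \<le> tail m / r\<^sup>2" for n
    proof -
      have sm: "summable (\<lambda>k. (d (k + m))\<^sup>2)" using d by (rule summable_ignore_initial_segment)
      have "(\<Sum>k<n. (d (m + k))\<^sup>2) \<le> tail m"
        unfolding tail_def using sum_le_suminf[OF sm, of "{..<n}"] by (simp add: add.commute)
      then show ?thesis
        unfolding E'_def
        by (intro order_trans[OF S.maximal_inequality[OF r, of n]] divide_right_mono) auto
    qed
    then show ?thesis using lim by (intro LIMSEQ_le_const2[OF lim]) auto
  qed
  have "AE \<omega> in M. \<exists>m. \<omega> \<notin> E r m" if r: "r > 0" for r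
  proof -
    have "prob (\<Inter>m. E r m) \<le> tail m / r\<^sup>2" for m
      by (rule order_trans[OF finite_measure_mono E[OF r, of m]]) auto
    moreover have "(\<lambda>m. tail m / r\<^sup>2) \<longlonglongrightarrow> 0"
      using tendsto_divide[OF tail0 tendsto_const, of "r\<^sup>2"] r by simp
    ultimately have "prob (\<Inter>m. E r m) \<le> 0"
      by (intro LIMSEQ_le_const[of _ 0]) auto
    then have "prob (\<Inter>m. E r m) = 0" by (simp add: measure_le_0_iff)
    then have "(\<Inter>m. E r m) \<in> null_sets M" by (simp add: null_sets_def emeasure_eq_measure)
    then show ?thesis by (rule AE_I'[of "\<Inter>m. E r m"]) auto
  qed
  then have "AE \<omega> in M. \<forall>i. \<exists>m. \<omega> \<notin> E (1 / real (Suc i)) m"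
    by (subst AE_all_countable) simp
  then show ?thesis
    using AE_space
  proof eventually_elim
    case (elim \<omega>)
    have "Cauchy (\<lambda>n. \<Sum>k<n. D k \<omega>)"
    proof (rule metric_CauchyI)
      fix e :: real assume "e > 0"
      then have "0 < e / 2" by simp
      then obtain i where i: "1 / real (Suc i) < e / 2" by (rule nat_approx_posE)
      obtain m where m: "\<omega> \<notin> E (1 / real (Suc i)) m" using elim(1) by blast
      have close: "\<bar>(\<Sum>k<n. D k \<omega>) - (\<Sum>k<m. D k \<omega>)\<bar> < e / 2" if nm: "n \<ge> m" for n
      proof -
        obtain j where j: "n = m + j" using le_Suc_ex[OF nm] by blast
        have "(\<Sum>k<n. D k \<omega>) = (\<Sum>k<m. D k \<omega>) + (\<Sum>k<j. D (m + k) \<omega>)"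
          unfolding j by (induction j) simp_all
        moreover have "\<bar>\<Sum>k<j. D (m + k) \<omega>\<bar> < 1 / real (Suc i)"
          using m elim(2) by (auto simp: E_def not_le)
        ultimately show ?thesis using i by linarith
      qed
      show "\<exists>N. \<forall>a\<ge>N. \<forall>b\<ge>N. dist (\<Sum>k<a. D k \<omega>) (\<Sum>k<b. D k \<omega>) < e"
      proof (intro exI allI impI)
        fix a b assume "m \<le> a" "m \<le> b"
        then show "dist (\<Sum>k<a. D k \<omega>) (\<Sum>k<b. D k \<omega>) < e"
          using close[of a] close[of b] unfolding dist_real_def by linarith
      qed
    qed
    then show ?case by (simp add: summable_iff_convergent Cauchy_convergent_iff)
  qed
qed

end

text \<open>
  A function of the past \<open>Y\<^sub>0, \<dots>, Y\<^sub>n\<close> and of the fresh observation \<open>Y\<^bsub>n+1\<^esub>\<close> that integrates to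
  \<open>0\<close> in the fresh observation is a martingale difference: independence makes the joint law a
  product, and Fubini's theorem integrates out the fresh observation first.
\<close>
lemma (in prob_space) martingale_differences_of_independent_sequence:
  fixes N :: "'b measure" and Y :: "nat \<Rightarrow> 'a \<Rightarrow> 'b" and f :: "nat \<Rightarrow> (nat \<Rightarrow> 'b) \<Rightarrow> 'b \<Rightarrow> real"
  defines "P n \<equiv> Pi\<^sub>M {..n} (\<lambda>_. N)" and "U n \<equiv> \<lambda>\<omega>. restrict (\<lambda>i. Y i \<omega>) {..n}"
  assumes indep: "indep_vars (\<lambda>_. N) Y UNIV"
    and f: "\<And>n. case_prod (f n) \<in> borel_measurable (P n \<Otimes>\<^sub>M N)"
    and bound: "\<And>n u z. \<bar>f n u z\<bar> \<le> d n"
    and mean: "\<And>n u. u \<in> space (P n) \<Longrightarrow> (\<integral>z. f n u z \<partial>distr M N (Y (Suc n))) = 0"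
  shows "bounded_martingale_differences M (\<lambda>n. vimage_algebra (space M) (U n) (P n))
    (\<lambda>n \<omega>. f n (U n \<omega>) (Y (Suc n) \<omega>)) d"
proof -
  let ?F = "\<lambda>n. vimage_algebra (space M) (U n) (P n)"
  have Y [measurable]: "Y n \<in> measurable M N" for n
    using indep by (auto simp: indep_vars_def)
  have U [measurable]: "U n \<in> measurable M (P n)" for n
    unfolding U_def P_def by (intro measurable_restrict) simp
  have UF: "U n \<in> measurable (?F n) (P n)" for n
    by (intro measurable_vimage_algebra1) (use measurable_space[OF U] in auto)
  have U_past: "U m \<in> measurable (?F n) (P m)" if "m \<le> n" for m n
  proof -
    have "(\<lambda>u. restrict u {..m}) \<in> measurable (P n) (P m)"
      unfolding P_def using that by (intro measurable_restrict_subset) auto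
    from measurable_compose[OF UF this] have "(\<lambda>\<omega>. restrict (U n \<omega>) {..m}) \<in> measurable (?F n) (P m)" .
    moreover have "(\<lambda>\<omega>. restrict (U n \<omega>) {..m}) = U m"
      using that by (auto simp: U_def fun_eq_iff restrict_def)
    ultimately show ?thesis by simp
  qed
  show ?thesis
  proof unfold_locales
    fix n
    show "subalgebra M (?F n)"
      unfolding subalgebra_def by (simp add: sets_image_in_sets[OF _ U])
    show "sets (?F m) \<subseteq> sets (?F n)" if "m \<le> n" for m
      by (rule sets_image_in_sets[OF _ U_past[OF that]]) simp
    have "(\<lambda>u. u (Suc n)) \<in> measurable (P (Suc n)) N"
      unfolding P_def by (rule measurable_component_singleton) simp
    from measurable_compose[OF UF this] have YF: "Y (Suc n) \<in> measurable (?F (Suc n)) N"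
      by (simp add: U_def)
    have "(\<lambda>\<omega>. (U n \<omega>, Y (Suc n) \<omega>)) \<in> measurable (?F (Suc n)) (P n \<Otimes>\<^sub>M N)"
      using U_past[of n "Suc n"] YF by (intro measurable_Pair) simp_all
    from measurable_compose[OF this f]
    show "(\<lambda>\<omega>. f n (U n \<omega>) (Y (Suc n) \<omega>)) \<in> borel_measurable (?F (Suc n))" by simp
    show "\<bar>f n (U n \<omega>) (Y (Suc n) \<omega>)\<bar> \<le> d n" for \<omega> by (rule bound)
    fix A assume "A \<in> sets (?F n)"
    moreover have "U n \<in> space M \<rightarrow> space (P n)" using measurable_space[OF U] by auto
    ultimately obtain B where B: "B \<in> sets (P n)" and A: "A = U n -` B \<inter> space M"
      by (auto simp: sets_vimage_algebra2)
    (* indep_var relates variables of one common type, so Y (Suc n) is represented by its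
       restriction to the index set {Suc n}. *)
    let ?N' = "Pi\<^sub>M {Suc n} (\<lambda>_. N)" and ?W = "\<lambda>\<omega>. restrict (\<lambda>i. Y i \<omega>) {Suc n}"
    let ?h = "\<lambda>(u, z). indicator B u * f n u (z (Suc n))"
    have W: "?W \<in> measurable M ?N'" by (intro measurable_restrict) simp
    have eval: "(\<lambda>z. z (Suc n)) \<in> measurable ?N' N"
      by (rule measurable_component_singleton) simp
    have fn: "(\<lambda>z. f n u z) \<in> borel_measurable N" if "u \<in> space (P n)" for u
      using measurable_compose[OF measurable_Pair1'[OF that] f[of n]] by simp
    have "(\<lambda>x. (fst x, snd x (Suc n))) \<in> measurable (P n \<Otimes>\<^sub>M ?N') (P n \<Otimes>\<^sub>M N)"
      by (intro measurable_Pair measurable_fst measurable_compose[OF measurable_snd eval])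
    from measurable_compose[OF this f[of n]] have h: "?h \<in> borel_measurable (P n \<Otimes>\<^sub>M ?N')"
      using B by (auto simp: split_def intro!: borel_measurable_times measurable_compose[OF measurable_fst])
    have "indep_var (P n) (U n) ?N' ?W"
      unfolding P_def U_def by (rule indep_var_restrict[OF indep]) auto
    then have joint: "distr M (P n) (U n) \<Otimes>\<^sub>M distr M ?N' ?W = distr M (P n \<Otimes>\<^sub>M ?N') (\<lambda>\<omega>. (U n \<omega>, ?W \<omega>))"
      unfolding indep_var_distribution_eq by simp
    interpret PU: prob_space "distr M (P n) (U n)" by (rule prob_space_distr[OF U])
    interpret PW: prob_space "distr M ?N' ?W" by (rule prob_space_distr[OF W])
    interpret pair_prob_space "distr M (P n) (U n)" "distr M ?N' ?W" ..
    have int: "integrable (distr M (P n) (U n) \<Otimes>\<^sub>M distr M ?N' ?W) ?h"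
    proof (rule P.integrable_const_bound[of _ "d n"])
      show "AE x in distr M (P n) (U n) \<Otimes>\<^sub>M distr M ?N' ?W. norm (?h x) \<le> d n"
        using bound[of n] order_trans[OF abs_ge_zero bound[of n]]
        by (intro AE_I2) (auto simp: indicator_def)
      show "?h \<in> borel_measurable (distr M (P n) (U n) \<Otimes>\<^sub>M distr M ?N' ?W)"
        unfolding joint using h by simp
    qed
    have mean': "(\<integral>z. f n u (z (Suc n)) \<partial>distr M ?N' ?W) = 0" if u: "u \<in> space (P n)" for u
      using mean[OF u] integral_distr[OF W measurable_compose[OF eval fn[OF u]]] integral_distr[OF Y fn[OF u]]
      by simp
    have "(\<integral>\<omega>. indicator A \<omega> * f n (U n \<omega>) (Y (Suc n) \<omega>) \<partial>M) = (\<integral>\<omega>. ?h (U n \<omega>, ?W \<omega>) \<partial>M)"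
      by (intro Bochner_Integration.integral_cong) (auto simp: A indicator_def)
    also have "\<dots> = (\<integral>x. ?h x \<partial>(distr M (P n) (U n) \<Otimes>\<^sub>M distr M ?N' ?W))"
      unfolding joint by (rule integral_distr[symmetric, OF _ h]) (intro measurable_Pair U W)
    also have "\<dots> = (\<integral>u. \<integral>z. ?h (u, z) \<partial>distr M ?N' ?W \<partial>distr M (P n) (U n))"
      by (rule integral_fst'[OF int, symmetric])
    also have "\<dots> = (\<integral>u. 0 \<partial>distr M (P n) (U n))"
      by (intro Bochner_Integration.integral_cong) (auto simp: mean')
    finally show "(\<integral>\<omega>. indicator A \<omega> * f n (U n \<omega>) (Y (Suc n) \<omega>) \<partial>M) = 0" by simp
  qed
qed

section \<open>Inequalities for log-sum-exp\<close>

lemma exp_le_quadratic: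
  fixes x :: real
  assumes "\<bar>x\<bar> \<le> 1"
  shows "exp x \<le> 1 + x + x\<^sup>2"
proof (cases "x \<ge> 0")
  case True
  then show ?thesis using exp_bound[of x] assms by simp
next
  case False
  have "exp x * (1 - x) \<le> exp x * exp (- x)"
    using exp_ge_add_one_self[of "-x"] by (intro mult_left_mono) auto
  also have "\<dots> = 1" by (simp add: exp_minus)
  also have "1 \<le> (1 + x + x\<^sup>2) * (1 - x)"
  proof -
    have "(1 + x + x\<^sup>2) * (1 - x) = 1 + (- x) * x\<^sup>2" by (simp add: algebra_simps power2_eq_square)
    moreover have "0 \<le> (- x) * x\<^sup>2" using False by (intro mult_nonneg_nonneg) auto
    ultimately show ?thesis by linarith
  qed
  finally show ?thesis using False by (simp add: mult_le_cancel_right)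
qed

lemma exp_gt_one_plus:
  fixes x :: real
  assumes "x \<noteq> 0"
  shows "1 + x < exp x"
proof (cases "x \<le> - 2")
  case True
  then show ?thesis using exp_gt_zero[of x] by linarith
next
  case False
  have "(1 + x / 2)\<^sup>2 = 1 + x + x\<^sup>2 / 4" by (simp add: power2_eq_square field_simps)
  moreover have "0 < x\<^sup>2" using assms by simp
  ultimately have "1 + x < (1 + x / 2)\<^sup>2" by linarith
  also have "\<dots> \<le> (exp (x / 2))\<^sup>2" using False exp_ge_add_one_self[of "x/2"] by (intro power_mono) auto
  also have "\<dots> = exp x" by (simp add: exp_double[symmetric])
  finally show ?thesis .
qed

text \<open>
  The tangents of \<open>exp\<close> at the mean \<open>p \<bullet> t\<close> average to \<open>exp (p \<bullet> t)\<close>. Comparing \<open>exp\<close> with these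
  tangents gives Jensen's inequality below, with its strict form.
\<close>
lemma mean_of_tangents:
  fixes p t :: "real ^ 'j::finite"
  assumes "(\<Sum>j\<in>UNIV. p $ j) = 1"
  shows "(\<Sum>j\<in>UNIV. p $ j * (exp (p \<bullet> t) * (1 + (t $ j - p \<bullet> t)))) = exp (p \<bullet> t)"
proof -
  have "(\<Sum>j\<in>UNIV. p $ j * (1 + (t $ j - p \<bullet> t))) = (\<Sum>j\<in>UNIV. p $ j + p $ j * t $ j - p $ j * (p \<bullet> t))"
    by (simp add: algebra_simps)
  also have "\<dots> = 1 + p \<bullet> t - 1 * (p \<bullet> t)"
    unfolding sum_subtractf sum.distrib assms sum_distrib_right[symmetric] by (simp add: inner_vec_def)
  finally have "(\<Sum>j\<in>UNIV. p $ j * (1 + (t $ j - p \<bullet> t))) = 1" by simp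
  then show ?thesis
    unfolding mult.left_commute[of _ "exp _"] sum_distrib_left[symmetric] by simp
qed

lemma log_sum_exp_ge:
  fixes p t :: "real ^ 'j::finite"
  assumes p: "\<And>j. 0 \<le> p $ j" and sum: "(\<Sum>j\<in>UNIV. p $ j) = 1"
  shows "p \<bullet> t \<le> ln (\<Sum>j\<in>UNIV. p $ j * exp (t $ j))"
proof -
  have "exp (p \<bullet> t) = (\<Sum>j\<in>UNIV. p $ j * (exp (p \<bullet> t) * (1 + (t $ j - p \<bullet> t))))"
    by (rule mean_of_tangents[OF sum, symmetric])
  also have "\<dots> \<le> (\<Sum>j\<in>UNIV. p $ j * (exp (p \<bullet> t) * exp (t $ j - p \<bullet> t)))"
    by (intro sum_mono mult_left_mono p) auto
  also have "\<dots> = (\<Sum>j\<in>UNIV. p $ j * exp (t $ j))"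
    by (simp add: exp_add[symmetric])
  finally show ?thesis by (simp add: ln_ge_iff less_le_trans[OF exp_gt_zero])
qed

lemma log_sum_exp_gt:
  fixes p t :: "real ^ 'j::finite"
  assumes p: "\<And>j. 0 < p $ j" and sum: "(\<Sum>j\<in>UNIV. p $ j) = 1" and i: "t $ i \<noteq> p \<bullet> t"
  shows "p \<bullet> t < ln (\<Sum>j\<in>UNIV. p $ j * exp (t $ j))"
proof -
  have "exp (p \<bullet> t) = (\<Sum>j\<in>UNIV. p $ j * (exp (p \<bullet> t) * (1 + (t $ j - p \<bullet> t))))"
    by (rule mean_of_tangents[OF sum, symmetric])
  also have "\<dots> < (\<Sum>j\<in>UNIV. p $ j * (exp (p \<bullet> t) * exp (t $ j - p \<bullet> t)))"
  proof (rule sum_strict_mono_ex1)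
    show "\<forall>j\<in>UNIV. p $ j * (exp (p \<bullet> t) * (1 + (t $ j - p \<bullet> t))) \<le> p $ j * (exp (p \<bullet> t) * exp (t $ j - p \<bullet> t))"
      using p by (auto intro!: mult_left_mono less_imp_le)
    show "\<exists>j\<in>UNIV. p $ j * (exp (p \<bullet> t) * (1 + (t $ j - p \<bullet> t))) < p $ j * (exp (p \<bullet> t) * exp (t $ j - p \<bullet> t))"
      using p[of i] exp_gt_one_plus[of "t $ i - p \<bullet> t"] i by (intro bexI[of _ i]) auto
  qed simp
  also have "\<dots> = (\<Sum>j\<in>UNIV. p $ j * exp (t $ j))"
    by (simp add: exp_add[symmetric])
  finally show ?thesis
    by (metis exp_gt_zero exp_less_cancel_iff exp_ln order_less_trans)
qed

text \<open>
  Bounded curvature of log-sum-exp. For \<open>norm t \<le> 1\<close> expand \<open>exp\<close> to second order. For larger \<open>t\<close>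
  both \<open>ln (\<Sum> p e\<^sup>t)\<close> and \<open>- (p \<bullet> t)\<close> are at most \<open>norm t \<le> (norm t)\<^sup>2\<close>, which accounts for the
  factor \<open>2\<close>.
\<close>
lemma log_sum_exp_le_quadratic:
  fixes p t :: "real ^ 'j::finite"
  assumes p: "\<And>j. 0 < p $ j" and sum: "(\<Sum>j\<in>UNIV. p $ j) = 1"
  shows "ln (\<Sum>j\<in>UNIV. p $ j * exp (t $ j)) \<le> p \<bullet> t + 2 * (norm t)\<^sup>2"
proof -
  have pos: "0 < (\<Sum>j\<in>UNIV. p $ j * exp (t $ j))" by (intro sum_pos mult_pos_pos p) auto
  have tj: "\<bar>t $ j\<bar> \<le> norm t" for j by (rule component_le_norm_cart)
  show ?thesis
  proof (cases "norm t \<le> 1")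
    case True
    have "(\<Sum>j\<in>UNIV. p $ j * exp (t $ j)) \<le> (\<Sum>j\<in>UNIV. p $ j * (1 + t $ j + (norm t)\<^sup>2))"
    proof (intro sum_mono mult_left_mono)
      fix j
      have "\<bar>t $ j\<bar> \<le> 1" using tj[of j] True by linarith
      moreover have "(t $ j)\<^sup>2 \<le> (norm t)\<^sup>2" using tj[of j] by (simp add: abs_le_square_iff[symmetric])
      ultimately show "exp (t $ j) \<le> 1 + t $ j + (norm t)\<^sup>2" using exp_le_quadratic[of "t $ j"] by linarith
    qed (use p in \<open>auto intro: less_imp_le\<close>)
    also have "\<dots> = 1 + (p \<bullet> t + (norm t)\<^sup>2)"
      by (simp add: distrib_left sum.distrib sum_distrib_right[symmetric] sum inner_vec_def)
    finally have "ln (\<Sum>j\<in>UNIV. p $ j * exp (t $ j)) \<le> p \<bullet> t + (norm t)\<^sup>2"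
      using pos ln_le_minus_one[OF pos] by linarith
    then show ?thesis using zero_le_power2[of "norm t"] by linarith
  next
    case False
    have "(\<Sum>j\<in>UNIV. p $ j * exp (t $ j)) \<le> (\<Sum>j\<in>UNIV. p $ j * exp (norm t))"
      using p tj by (intro sum_mono mult_left_mono) (auto intro: less_imp_le order_trans[OF abs_ge_self])
    also have "\<dots> = exp (norm t)" by (simp add: sum_distrib_right[symmetric] sum)
    finally have "ln (\<Sum>j\<in>UNIV. p $ j * exp (t $ j)) \<le> norm t" using pos by (simp add: ln_le_cancel_iff[symmetric])
    moreover have "- (p \<bullet> t) \<le> norm t"
    proof -
      have "- (p \<bullet> t) = (\<Sum>j\<in>UNIV. p $ j * (- t $ j))" by (simp add: inner_vec_def sum_negf)
      also have "\<dots> \<le> (\<Sum>j\<in>UNIV. p $ j * norm t)"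
        using p tj by (intro sum_mono mult_left_mono) (auto intro: less_imp_le order_trans[OF abs_ge_minus_self])
      finally show ?thesis by (simp add: sum_distrib_right[symmetric] sum)
    qed
    moreover have "norm t \<le> (norm t)\<^sup>2"
      using False mult_left_mono[of 1 "norm t" "norm t"] by (simp add: power2_eq_square)
    ultimately show ?thesis by linarith
  qed
qed

lemma norm_nonneg_sum_one_le:
  fixes p :: "real ^ 'j::finite"
  assumes "\<And>j. 0 \<le> p $ j" "(\<Sum>j\<in>UNIV. p $ j) = 1"
  shows "norm p \<le> 1"
  using norm_le_l1_cart[of p] assms by simp

section \<open>Centered vectors and their projection\<close>

lemma norm_outer_square: "norm (outer_square u) = (norm u)\<^sup>2" for u :: "real ^ 'j::finite"
proof -
  have "outer_square u $ i = u $ i *\<^sub>R u" for i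
    by (simp add: outer_square_def vec_eq_iff)
  then have "norm (outer_square u) = L2_set (\<lambda>i. norm (u $ i) * norm u) UNIV"
    unfolding norm_vec_def[of "outer_square u"] by simp
  also have "\<dots> = (norm u)\<^sup>2"
    unfolding power2_eq_square by (simp add: L2_set_left_distrib[symmetric] norm_vec_def[of u])
  finally show ?thesis .
qed

lemma centered_iff_inner: "v \<in> centered \<longleftrightarrow> unit_dir \<bullet> v = 0" for v :: "real ^ 'j::finite"
  unfolding orthogonal_comp_def orthogonal_def
  using span_base[of unit_dir "{unit_dir}"] by (auto simp: span_singleton)

lemma centered_iff: "v \<in> centered \<longleftrightarrow> (\<Sum>j\<in>UNIV. v $ j) = 0" for v :: "real ^ 'j::finite"
proof -
  have "unit_dir \<bullet> v = (\<Sum>j\<in>UNIV. v $ j) / sqrt (real CARD('j))"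
    by (simp add: unit_dir_def inner_vec_def sum_divide_distrib)
  then show ?thesis by (simp add: centered_iff_inner)
qed

lemma outer_square_mult: "outer_square u *v x = (u \<bullet> x) *\<^sub>R u" for u :: "real ^ 'j::finite"
  by (simp add: vec_eq_iff outer_square_def matrix_vector_mult_def inner_vec_def sum_distrib_left mult_ac)

lemma norm_unit_dir: "norm (unit_dir :: real ^ 'j::finite) = 1"
proof -
  have "(norm (unit_dir :: real ^ 'j))\<^sup>2 = 1"
    unfolding power2_norm_eq_inner by (simp add: unit_dir_def inner_vec_def)
  then show ?thesis by (simp add: power2_eq_1_iff) (metis norm_ge_zero not_one_le_zero neg_0_le_iff_le order_trans)
qed

lemma proj_mat_mult: "proj_mat *v x = x - (unit_dir \<bullet> x) *\<^sub>R unit_dir" for x :: "real ^ 'j::finite"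
  by (simp add: proj_mat_def matrix_vector_mult_diff_rdistrib outer_square_mult)

lemma proj_mat_centered: "proj_mat *v x \<in> centered" for x :: "real ^ 'j::finite"
  using norm_unit_dir[where 'j = 'j]
  by (simp add: centered_iff_inner proj_mat_mult inner_diff_right power2_norm_eq_inner[symmetric])

lemma proj_mat_fixes_centered: "x \<in> centered \<Longrightarrow> proj_mat *v x = x" for x :: "real ^ 'j::finite"
  by (simp add: centered_iff_inner proj_mat_mult)

lemma inner_proj_mat: "y \<in> centered \<Longrightarrow> y \<bullet> (proj_mat *v x) = y \<bullet> x" for x y :: "real ^ 'j::finite"
  by (simp add: centered_iff_inner proj_mat_mult inner_diff_right inner_commute)

lemma norm_proj_mat_le: "norm (proj_mat *v x) \<le> norm x" for x :: "real ^ 'j::finite"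
proof -
  have "(norm (proj_mat *v x))\<^sup>2 = (proj_mat *v x) \<bullet> x"
    unfolding power2_norm_eq_inner by (rule inner_proj_mat[OF proj_mat_centered])
  also have "\<dots> \<le> norm (proj_mat *v x) * norm x" by (rule norm_cauchy_schwarz)
  finally show ?thesis
    by (cases "norm (proj_mat *v x) = 0") (auto simp: power2_eq_square mult_le_cancel_left_pos)
qed

section \<open>The semi-discrete objective\<close>

text \<open>
  Here \<open>Q\<close> is the law of the cost vector. The functions of the algorithm are instantiated with
  coordinate evaluation \<open>($)\<close> as cost and \<open>id\<close> as enumeration of the target points.
\<close>
locale semidiscrete_objective = prob_space Q
  for Q :: "(real ^ 'j::finite) measure" +
  fixes \<epsilon> :: real and w :: "real ^ 'j"
  assumes sets_Q [measurable_cong]: "sets Q = sets borel"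
    and integrable_cost: "integrable Q (\<lambda>z. z)"
    and eps: "\<epsilon> > 0"
    and w_pos: "\<And>j. w $ j > 0"
    and w_sum: "(\<Sum>j\<in>UNIV. w $ j) = 1"
begin

abbreviation \<pi> :: "real ^ 'j \<Rightarrow> real ^ 'j \<Rightarrow> real ^ 'j" where
  "\<pi> \<equiv> pi_eps \<epsilon> ($) id w"

abbreviation g :: "real ^ 'j \<Rightarrow> real ^ 'j \<Rightarrow> real ^ 'j" where
  "g \<equiv> grad_h \<epsilon> ($) id w"

abbreviation h :: "real ^ 'j \<Rightarrow> real ^ 'j \<Rightarrow> real" where
  "h \<equiv> h_eps \<epsilon> ($) id w"

abbreviation H :: "real ^ 'j \<Rightarrow> real" where
  "H \<equiv> H_eps Q \<epsilon> ($) id w"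

abbreviation G :: "real ^ 'j \<Rightarrow> real ^ 'j ^ 'j" where
  "G \<equiv> G_eps Q \<epsilon> ($) id w"

definition grad_H :: "real ^ 'j \<Rightarrow> real ^ 'j" where
  "grad_H v = (\<integral>z. g z v \<partial>Q)"

lemma partition_pos: "0 < (\<Sum>k\<in>UNIV. w $ k * exp ((v $ k - z $ k) / \<epsilon>))"
  by (intro sum_pos mult_pos_pos w_pos) auto

lemma pi_pos: "0 < \<pi> z v $ j"
  using partition_pos[of v z] w_pos[of j] by (simp add: pi_eps_def)

lemma pi_sum: "(\<Sum>j\<in>UNIV. \<pi> z v $ j) = 1"
  using partition_pos[of v z] by (simp add: pi_eps_def sum_divide_distrib[symmetric])

lemma norm_g: "norm (g z v) \<le> 2"
proof -
  have "norm (g z v) \<le> norm (\<pi> z v) + norm w"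
    unfolding grad_h_def by (rule norm_triangle_ineq4)
  also have "\<dots> \<le> 1 + 1"
    using norm_nonneg_sum_one_le[OF less_imp_le[OF pi_pos] pi_sum, of z v]
      norm_nonneg_sum_one_le[OF less_imp_le[OF w_pos] w_sum] by linarith
  finally show ?thesis by simp
qed

lemma g_sum: "(\<Sum>j\<in>UNIV. g z v $ j) = 0"
  by (simp add: grad_h_def sum_subtractf pi_sum w_sum)

lemma continuous_g: "continuous_on UNIV (\<lambda>(z, v). g z v)"
proof -
  have "(\<Sum>k\<in>UNIV. w $ k * exp ((v $ k - z $ k) / \<epsilon>)) \<noteq> 0" for v z
    using partition_pos[of v z] by simp
  then show ?thesis
    unfolding grad_h_def pi_eps_def split_def id_apply
    using eps by (intro continuous_intros ballI) simp_all
qed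

lemma measurable_g [measurable]: "(\<lambda>(z, v). g z v) \<in> borel_measurable (borel \<Otimes>\<^sub>M borel)"
  unfolding borel_prod by (rule borel_measurable_continuous_onI[OF continuous_g])

lemma measurable_g_fst [measurable]: "(\<lambda>z. g z v) \<in> borel_measurable Q"
proof -
  have "(\<lambda>z. (\<lambda>(z, v). g z v) (z, v)) \<in> borel_measurable borel"
    by (rule measurable_compose[OF _ measurable_g]) simp
  then show ?thesis by (simp add: measurable_cong_sets[OF sets_Q refl])
qed

text \<open>
  Increments of \<open>h\<close> from \<open>v\<close> are log-sum-exp values with respect to the probability vector \<open>\<pi> z v\<close>,
  up to a linear term. All convexity and smoothness properties of \<open>h\<close> follow from this.
\<close>
lemma h_diff:
  "h z u - h z v = \<epsilon> * ln (\<Sum>j\<in>UNIV. \<pi> z v $ j * exp ((inverse \<epsilon> *\<^sub>R (u - v)) $ j)) - w \<bullet> (u - v)"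
proof -
  let ?s = "\<lambda>v. \<Sum>k\<in>UNIV. w $ k * exp ((v $ k - z $ k) / \<epsilon>)"
  have "(\<Sum>j\<in>UNIV. \<pi> z v $ j * exp ((inverse \<epsilon> *\<^sub>R (u - v)) $ j)) = ?s u / ?s v"
    unfolding sum_divide_distrib
  proof (rule sum.cong)
    fix j
    have "exp ((v $ j - z $ j) / \<epsilon>) * exp ((inverse \<epsilon> *\<^sub>R (u - v)) $ j) = exp ((u $ j - z $ j) / \<epsilon>)"
      using eps by (simp add: exp_add[symmetric] field_simps)
    then show "\<pi> z v $ j * exp ((inverse \<epsilon> *\<^sub>R (u - v)) $ j) = w $ j * exp ((u $ j - z $ j) / \<epsilon>) / ?s v"
      by (simp add: pi_eps_def mult.assoc)
  qed simp
  moreover have "h z x = \<epsilon> + \<epsilon> * ln (?s x) - w \<bullet> x" for x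
    by (simp add: h_eps_def inner_vec_def mult.commute)
  ultimately show ?thesis
    using partition_pos[of u z] partition_pos[of v z]
    by (simp add: ln_div right_diff_distrib inner_diff_right)
qed

lemma h_gradient_inequality: "h z v + g z v \<bullet> (u - v) \<le> h z u"
proof -
  let ?t = "inverse \<epsilon> *\<^sub>R (u - v)"
  have "\<epsilon> * (\<pi> z v \<bullet> ?t) \<le> \<epsilon> * ln (\<Sum>j\<in>UNIV. \<pi> z v $ j * exp (?t $ j))"
    using eps by (intro mult_left_mono log_sum_exp_ge[OF less_imp_le[OF pi_pos] pi_sum]) simp
  moreover have "\<epsilon> * (\<pi> z v \<bullet> ?t) = \<pi> z v \<bullet> (u - v)" using eps by simp
  ultimately show ?thesis
    using h_diff[of z u v] unfolding grad_h_def inner_diff_left by linarith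
qed

text \<open>
  Equality in Jensen's inequality needs \<open>u - v\<close> to have equal coordinates, and the only such vector
  in the centered subspace is \<open>0\<close>.
\<close>
lemma h_gradient_inequality_strict:
  assumes "u - v \<in> centered" "u \<noteq> v"
  shows "h z v + g z v \<bullet> (u - v) < h z u"
proof -
  define t where "t = inverse \<epsilon> *\<^sub>R (u - v)"
  have "\<exists>i. t $ i \<noteq> \<pi> z v \<bullet> t"
  proof (rule ccontr)
    assume "\<not> ?thesis"
    then have const: "t $ i = \<pi> z v \<bullet> t" for i by blast
    have "(\<Sum>j\<in>UNIV. t $ j) = 0"
      using assms(1) by (simp add: t_def centered_iff sum_distrib_left[symmetric])
    then have "real CARD('j) * (\<pi> z v \<bullet> t) = 0" unfolding const by simp
    then have "t = 0" using const by (simp add: vec_eq_iff)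
    then show False using assms(2) eps by (simp add: t_def)
  qed
  then obtain i where "t $ i \<noteq> \<pi> z v \<bullet> t" by blast
  then have "\<epsilon> * (\<pi> z v \<bullet> t) < \<epsilon> * ln (\<Sum>j\<in>UNIV. \<pi> z v $ j * exp (t $ j))"
    using eps by (intro mult_strict_left_mono log_sum_exp_gt[OF pi_pos pi_sum])
  moreover have "\<epsilon> * (\<pi> z v \<bullet> t) = \<pi> z v \<bullet> (u - v)" using eps by (simp add: t_def)
  ultimately show ?thesis
    using h_diff[of z u v] unfolding grad_h_def inner_diff_left t_def by linarith
qed

lemma h_smooth: "h z u \<le> h z v + g z v \<bullet> (u - v) + 2 / \<epsilon> * (norm (u - v))\<^sup>2"
proof -
  let ?t = "inverse \<epsilon> *\<^sub>R (u - v)"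
  have "\<epsilon> * ln (\<Sum>j\<in>UNIV. \<pi> z v $ j * exp (?t $ j)) \<le> \<epsilon> * (\<pi> z v \<bullet> ?t + 2 * (norm ?t)\<^sup>2)"
    using eps by (intro mult_left_mono log_sum_exp_le_quadratic[OF pi_pos pi_sum]) simp
  also have "norm ?t = inverse \<epsilon> * norm (u - v)" using eps by simp
  also have "\<epsilon> * (\<pi> z v \<bullet> ?t + 2 * (inverse \<epsilon> * norm (u - v))\<^sup>2)
      = \<pi> z v \<bullet> (u - v) + 2 / \<epsilon> * (norm (u - v))\<^sup>2"
    unfolding inner_scaleR_right using eps by (simp add: field_simps power2_eq_square)
  finally show ?thesis
    using h_diff[of z u v] unfolding grad_h_def inner_diff_left by linarith
qed

lemma h_growth: "\<bar>h z v\<bar> \<le> \<epsilon> + 2 * norm v + norm z"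
proof -
  let ?s = "\<Sum>k\<in>UNIV. w $ k * exp ((inverse \<epsilon> *\<^sub>R (v - z)) $ k)"
  have h: "h z v = \<epsilon> + \<epsilon> * ln ?s - w \<bullet> v"
    by (simp add: h_eps_def inner_vec_def mult.commute divide_inverse)
  have s: "0 < ?s" by (intro sum_pos mult_pos_pos w_pos) auto
  have nw: "norm w \<le> 1" by (rule norm_nonneg_sum_one_le[OF less_imp_le[OF w_pos] w_sum])
  have wx: "\<bar>w \<bullet> x\<bar> \<le> norm x" for x
    using Cauchy_Schwarz_ineq2[of w x] mult_right_mono[OF nw, of "norm x"] by simp
  have n: "norm (inverse \<epsilon> *\<^sub>R (v - z)) \<le> inverse \<epsilon> * (norm v + norm z)"
    using eps norm_triangle_ineq4[of v z] by simp
  have "?s \<le> (\<Sum>k\<in>UNIV. w $ k * exp (inverse \<epsilon> * (norm v + norm z)))"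
    using n component_le_norm_cart[of "inverse \<epsilon> *\<^sub>R (v - z)"] w_pos
    by (intro sum_mono mult_left_mono) (auto simp: abs_le_iff intro: less_imp_le order_trans simp del: norm_scaleR)
  also have "\<dots> = exp (inverse \<epsilon> * (norm v + norm z))"
    by (simp add: sum_distrib_right[symmetric] w_sum)
  finally have "ln ?s \<le> inverse \<epsilon> * (norm v + norm z)"
    using s by (metis exp_gt_zero ln_exp ln_le_cancel_iff)
  moreover have "- (inverse \<epsilon> * (norm v + norm z)) \<le> ln ?s"
    using log_sum_exp_ge[OF less_imp_le[OF w_pos] w_sum, of "inverse \<epsilon> *\<^sub>R (v - z)"]
      wx[of "inverse \<epsilon> *\<^sub>R (v - z)"] n by linarith
  ultimately have "\<bar>ln ?s\<bar> \<le> inverse \<epsilon> * (norm v + norm z)" by linarith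
  then have "\<epsilon> * \<bar>ln ?s\<bar> \<le> \<epsilon> * (inverse \<epsilon> * (norm v + norm z))"
    using eps by (intro mult_left_mono) simp_all
  also have "\<dots> = norm v + norm z" using eps by simp
  finally have "\<bar>\<epsilon> * ln ?s\<bar> \<le> norm v + norm z"
    unfolding abs_mult using eps by simp
  then show ?thesis unfolding h using wx[of v] eps by linarith
qed

lemma continuous_h: "continuous_on UNIV (\<lambda>z. h z v)"
proof -
  have "0 < (\<Sum>k\<in>UNIV. exp ((v $ k - z $ k) / \<epsilon>) * w $ k)" for z
    using partition_pos[of v z] by (simp add: mult.commute)
  then have "(\<Sum>k\<in>UNIV. exp ((v $ k - z $ k) / \<epsilon>) * w $ k) \<noteq> 0" for z
    by (metis less_irrefl)
  then show ?thesis
    unfolding h_eps_def id_apply using eps by (intro continuous_intros ballI) simp_all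
qed

lemma integrable_h: "integrable Q (\<lambda>z. h z v)"
proof (rule Bochner_Integration.integrable_bound)
  show "integrable Q (\<lambda>z. \<epsilon> + 2 * norm v + norm z)"
    using integrable_norm[OF integrable_cost] by auto
  show "(\<lambda>z. h z v) \<in> borel_measurable Q"
    using borel_measurable_continuous_onI[OF continuous_h] by measurable
  show "AE z in Q. norm (h z v) \<le> norm (\<epsilon> + 2 * norm v + norm z)"
    using h_growth by (intro AE_I2) (auto intro: order_trans[OF _ abs_ge_self])
qed

lemma integrable_g: "integrable Q (\<lambda>z. g z v)"
  by (rule integrable_const_bound[of _ 2]) (auto simp: norm_g)

lemma integrable_g_inner: "integrable Q (\<lambda>z. g z v \<bullet> u)"
  by (rule integrable_inner_left) (rule integrable_g)

lemma grad_H_inner: "grad_H v \<bullet> u = (\<integral>z. g z v \<bullet> u \<partial>Q)"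
  unfolding grad_H_def by (simp add: integrable_g)

lemma norm_grad_H: "norm (grad_H v) \<le> 2"
proof -
  have "norm (grad_H v) \<le> (\<integral>z. norm (g z v) \<partial>Q)" unfolding grad_H_def by (rule integral_norm_bound)
  also have "\<dots> \<le> (\<integral>z. 2 \<partial>Q)"
    by (intro integral_mono integrable_norm integrable_g norm_g) auto
  finally show ?thesis by (simp add: prob_space)
qed

lemma grad_H_sum: "(\<Sum>j\<in>UNIV. grad_H v $ j) = 0"
proof -
  have "grad_H v \<bullet> (\<chi> j. 1) = 0"
    unfolding grad_H_inner by (simp add: inner_vec_def g_sum)
  then show ?thesis by (simp add: inner_vec_def)
qed

lemma H_gradient_inequality: "H v + grad_H v \<bullet> (u - v) \<le> H u"
proof -
  have "H v + grad_H v \<bullet> (u - v) = (\<integral>z. h z v + g z v \<bullet> (u - v) \<partial>Q)"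
    unfolding H_eps_def grad_H_inner by (simp add: integrable_h integrable_g_inner)
  also have "\<dots> \<le> H u" unfolding H_eps_def
    by (intro integral_mono Bochner_Integration.integrable_add integrable_h integrable_g_inner h_gradient_inequality)
  finally show ?thesis .
qed

lemma H_gradient_inequality_strict:
  assumes "u - v \<in> centered" "u \<noteq> v"
  shows "H v + grad_H v \<bullet> (u - v) < H u"
proof -
  have "H v + grad_H v \<bullet> (u - v) = (\<integral>z. h z v + g z v \<bullet> (u - v) \<partial>Q)"
    unfolding H_eps_def grad_H_inner by (simp add: integrable_h integrable_g_inner)
  also have "\<dots> < H u" unfolding H_eps_def
    by (intro integral_less_AE_space Bochner_Integration.integrable_add integrable_h integrable_g_inner)
       (auto simp: h_gradient_inequality_strict[OF assms] emeasure_space_1)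
  finally show ?thesis .
qed

lemma H_smooth: "H u \<le> H v + grad_H v \<bullet> (u - v) + 2 / \<epsilon> * (norm (u - v))\<^sup>2"
proof -
  have "H u \<le> (\<integral>z. h z v + g z v \<bullet> (u - v) + 2 / \<epsilon> * (norm (u - v))\<^sup>2 \<partial>Q)" unfolding H_eps_def
    by (intro integral_mono Bochner_Integration.integrable_add integrable_h integrable_g_inner h_smooth) auto
  also have "\<dots> = H v + grad_H v \<bullet> (u - v) + 2 / \<epsilon> * (norm (u - v))\<^sup>2"
    unfolding H_eps_def grad_H_inner by (simp add: integrable_h integrable_g_inner prob_space)
  finally show ?thesis .
qed

lemma H_lipschitz: "\<bar>H u - H v\<bar> \<le> 2 * norm (u - v)"
proof -
  have "H v - H u \<le> 2 * norm (u - v)" for u v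
  proof -
    have "\<bar>grad_H v \<bullet> (u - v)\<bar> \<le> 2 * norm (u - v)"
      using Cauchy_Schwarz_ineq2[of "grad_H v" "u - v"] mult_right_mono[OF norm_grad_H[of v], of "norm (u - v)"]
      by simp
    then show ?thesis using H_gradient_inequality[of v u] by linarith
  qed
  from this[of u v] this[of v u] show ?thesis by (simp add: norm_minus_commute abs_le_iff)
qed

lemma continuous_H: "continuous_on A H"
proof (rule continuous_onI)
  fix x e assume "e > (0::real)"
  then show "\<exists>d>0. \<forall>x'\<in>A. dist x' x < d \<longrightarrow> dist (H x') (H x) \<le> e"
    using H_lipschitz[of _ x] unfolding dist_norm real_norm_def
    by (intro exI[of _ "e/2"]) (smt (verit) field_sum_of_halves half_gt_zero)
qed

lemma continuous_outer_square: "continuous_on UNIV (outer_square :: real ^ 'j \<Rightarrow> _)"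
  unfolding outer_square_def by (intro continuous_intros continuous_on_vec_lambda)

lemma outer_square_g_measurable: "(\<lambda>z. outer_square (g z v)) \<in> borel_measurable Q"
  by (rule measurable_compose[OF measurable_g_fst borel_measurable_continuous_onI[OF continuous_outer_square]])

lemma tendsto_G:
  assumes "V \<longlonglongrightarrow> v"
  shows "(\<lambda>n. G (V n)) \<longlonglongrightarrow> G v"
  unfolding G_eps_def
proof (rule integral_dominated_convergence[where w = "\<lambda>_. 4"])
  show "(\<lambda>z. outer_square (g z v)) \<in> borel_measurable Q" by (rule outer_square_g_measurable)
  show "(\<lambda>z. outer_square (g z (V n))) \<in> borel_measurable Q" for n by (rule outer_square_g_measurable)
  have "(\<lambda>n. g z (V n)) \<longlonglongrightarrow> g z v" for z
    using continuous_on_tendsto_compose[OF continuous_g tendsto_Pair[OF tendsto_const[of z] assms]] by simp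
  then show "AE z in Q. (\<lambda>n. outer_square (g z (V n))) \<longlonglongrightarrow> outer_square (g z v)"
    using continuous_on_tendsto_compose[OF continuous_outer_square] by (intro AE_I2) auto
  show "AE z in Q. norm (outer_square (g z (V n))) \<le> 4" for n
    using power_mono[OF norm_g, of _ _ 2] by (auto simp: norm_outer_square)
qed simp

text \<open>
  The minimizer is unique: with a second one, the strict gradient inequality at the midpoint would
  make \<open>H\<close> smaller there. Compactness of the centered sphere then makes the gap uniform.
\<close>
lemma minimizer_gap:
  assumes v0: "v0 \<in> centered" "\<And>u. u \<in> centered \<Longrightarrow> H v0 \<le> H u" and r: "r > 0"
  obtains m where "m > 0" "\<And>u. u \<in> centered \<Longrightarrow> norm (u - v0) = r \<Longrightarrow> H v0 + m \<le> H u"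
proof -
  have gap: "H v0 < H u" if u: "u \<in> centered" "u \<noteq> v0" for u
  proof -
    let ?p = "(1/2) *\<^sub>R (u + v0)"
    have up: "u - ?p = (1/2) *\<^sub>R (u - v0)" and vp: "v0 - ?p = (1/2) *\<^sub>R (v0 - u)"
      by (simp_all add: algebra_simps vec_eq_iff)
    have c: "(1/2) *\<^sub>R (u - v0) \<in> centered" "(1/2) *\<^sub>R (v0 - u) \<in> centered" "?p \<in> centered"
      using u v0 by (auto simp: centered_iff sum_subtractf sum.distrib sum_distrib_left[symmetric] sum_divide_distrib[symmetric])
    have "H ?p + grad_H ?p \<bullet> (u - ?p) < H u"
      by (rule H_gradient_inequality_strict) (use c up u in \<open>auto\<close>)
    moreover have "H ?p + grad_H ?p \<bullet> (v0 - ?p) \<le> H v0"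
      by (rule H_gradient_inequality)
    moreover have "grad_H ?p \<bullet> (u - ?p) + grad_H ?p \<bullet> (v0 - ?p) = 0"
      unfolding up vp by (simp add: inner_diff_right field_simps)
    moreover have "H v0 \<le> H ?p" using v0(2) c(3) .
    ultimately show ?thesis by linarith
  qed
  let ?S = "sphere v0 r \<inter> centered"
  show thesis
  proof (cases "?S = {}")
    case True
    have "H v0 + 1 \<le> H u" if "u \<in> centered" "norm (u - v0) = r" for u
    proof -
      have "u \<in> ?S" using that by (simp add: dist_norm norm_minus_commute)
      then show ?thesis using True by blast
    qed
    then show thesis by (intro that[of 1]) auto
  next
    case False
    have "compact ?S" by (intro compact_Int_closed closed_subspace subspace_orthogonal_comp) auto
    from continuous_attains_inf[OF this False continuous_H]
    obtain u where u: "u \<in> ?S" "\<And>x. x \<in> ?S \<Longrightarrow> H u \<le> H x" by blast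
    then have "H v0 < H u" using r by (intro gap) auto
    then show thesis
      by (intro that[of "H u - H v0"]) (use u in \<open>auto simp: dist_norm norm_minus_commute\<close>)
  qed
qed

text \<open>
  The gap on the sphere of radius \<open>r\<close> propagates outwards by convexity: along a ray from the
  minimizer the slope of \<open>H\<close> does not decrease, and it is at least \<open>m / r\<close> where the ray meets the
  sphere.
\<close>
lemma far_from_minimizer:
  assumes v0: "v0 \<in> centered" "\<And>u. u \<in> centered \<Longrightarrow> H v0 \<le> H u" and r: "r > 0"
  obtains m where "m > 0"
    "\<And>v. v \<in> centered \<Longrightarrow> r \<le> norm (v - v0) \<Longrightarrow> H v0 + m \<le> H v \<and> m \<le> norm (grad_H v)"
proof -
  obtain m where m: "m > 0" "\<And>u. u \<in> centered \<Longrightarrow> norm (u - v0) = r \<Longrightarrow> H v0 + m \<le> H u"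
    using minimizer_gap[OF v0 r] by blast
  have main: "H v0 + m \<le> H v \<and> m / r \<le> norm (grad_H v)" if v: "v \<in> centered" "r \<le> norm (v - v0)" for v
  proof -
    define \<rho> where "\<rho> = norm (v - v0)"
    have \<rho>: "r \<le> \<rho>" "0 < \<rho>" using v r by (auto simp: \<rho>_def)
    (* u is the point where the segment from v0 to v meets the sphere. *)
    define u where "u = v0 + (r / \<rho>) *\<^sub>R (v - v0)"
    have uv0: "u - v0 = (r / \<rho>) *\<^sub>R (v - v0)" by (simp add: u_def)
    have vu: "v - u = (1 - r / \<rho>) *\<^sub>R (v - v0)" by (simp add: u_def scaleR_diff_left)
    have "u \<in> centered"
      using v v0 by (auto simp: u_def centered_iff sum.distrib sum_subtractf sum_distrib_left[symmetric] simp flip: sum_divide_distrib)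
    moreover have "norm (u - v0) = r" unfolding uv0 using \<rho> r by (simp add: \<rho>_def[symmetric])
    ultimately have Hu: "H v0 + m \<le> H u" by (rule m(2))
    define a where "a = grad_H u \<bullet> (v - v0)"
    have "H u + grad_H u \<bullet> (v0 - u) \<le> H v0" by (rule H_gradient_inequality)
    moreover have "grad_H u \<bullet> (v0 - u) = - (r / \<rho>) * a"
      unfolding a_def using uv0 by (metis inner_minus_right inner_scaleR_right minus_diff_eq mult_minus_left)
    ultimately have "m \<le> (r / \<rho>) * a" using Hu by simp
    then have am: "m * \<rho> / r \<le> a" using r \<rho> by (simp add: field_simps)
    have a: "0 \<le> a" using am m(1) r \<rho> by (meson divide_nonneg_pos less_imp_le mult_nonneg_nonneg order_trans)
    have t: "0 \<le> 1 - r / \<rho>" using \<rho> r by simp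
    have 1: "H u + grad_H u \<bullet> (v - u) \<le> H v" by (rule H_gradient_inequality)
    have 2: "grad_H u \<bullet> (v - u) = (1 - r / \<rho>) * a" unfolding vu a_def by simp
    have 3: "0 \<le> (1 - r / \<rho>) * a" using t a by simp
    have Hv: "H v0 + m \<le> H v" using 1 2 3 Hu by linarith
    have "m / r \<le> norm (grad_H v)"
    proof -
      have "m * \<rho> / r \<le> grad_H v \<bullet> (v - v0)"
      proof (cases "\<rho> = r")
        case True
        have "H v + grad_H v \<bullet> (v0 - v) \<le> H v0" by (rule H_gradient_inequality)
        then have "m \<le> grad_H v \<bullet> (v - v0)" using Hv by (simp add: inner_diff_right)
        then show ?thesis using True r by simp
      next
        case False
        then have t: "0 < 1 - r / \<rho>" using \<rho> r by simp
        have "H v + grad_H v \<bullet> (u - v) \<le> H u" by (rule H_gradient_inequality)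
        moreover have "grad_H v \<bullet> (u - v) = - ((1 - r / \<rho>) * (grad_H v \<bullet> (v - v0)))"
          using vu by (metis inner_minus_right inner_scaleR_right minus_diff_eq)
        ultimately have "(1 - r / \<rho>) * a \<le> (1 - r / \<rho>) * (grad_H v \<bullet> (v - v0))" using 1 2 by linarith
        then have "a \<le> grad_H v \<bullet> (v - v0)" using t by (simp add: mult_le_cancel_left_pos)
        then show ?thesis using am by linarith
      qed
      also have "\<dots> \<le> norm (grad_H v) * \<rho>" unfolding \<rho>_def by (rule norm_cauchy_schwarz)
      finally show ?thesis using \<rho> r by (simp add: field_simps)
    qed
    with Hv show ?thesis by blast
  qed
  show thesis
  proof (rule that[of "min m (m / r)"])
    show "0 < min m (m / r)" using m(1) r by simp
    show "H v0 + min m (m / r) \<le> H v \<and> min m (m / r) \<le> norm (grad_H v)"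
      if "v \<in> centered" "r \<le> norm (v - v0)" for v
      using main[OF that] by auto
  qed
qed

text \<open>
  Small gradients bring \<open>V\<close> back near \<open>v0\<close> infinitely often. As \<open>H\<close> is Lipschitz, this fixes the
  limit of \<open>H (V n)\<close> as \<open>H v0\<close>, and then the gap of \<open>H\<close> away from \<open>v0\<close> confines \<open>V\<close>.
\<close>
theorem converges_to_minimizer:
  assumes v0: "v0 \<in> centered" "\<And>u. u \<in> centered \<Longrightarrow> H v0 \<le> H u"
    and V: "\<And>n. V n \<in> centered" and conv: "convergent (\<lambda>n. H (V n))"
    and small: "\<And>\<delta>. \<delta> > 0 \<Longrightarrow> \<exists>\<^sub>F n in sequentially. norm (grad_H (V n)) < \<delta>"
  shows "V \<longlonglongrightarrow> v0"
proof -
  obtain L where L: "(\<lambda>n. H (V n)) \<longlonglongrightarrow> L" using conv by (auto simp: convergent_def)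
  have "H v0 \<le> L" using L v0(2) V by (intro LIMSEQ_le_const) auto
  have "L \<le> H v0 + 2 * r" if r: "r > 0" for r
  proof (rule ccontr)
    assume "\<not> ?thesis"
    then have "\<forall>\<^sub>F n in sequentially. H (V n) > H v0 + 2 * r" using L by (intro order_tendstoD) auto
    moreover obtain m where m: "m > 0"
        "\<And>v. v \<in> centered \<Longrightarrow> r \<le> norm (v - v0) \<Longrightarrow> H v0 + m \<le> H v \<and> m \<le> norm (grad_H v)"
      using far_from_minimizer[OF v0 r] by blast
    ultimately have "\<exists>\<^sub>F n in sequentially. norm (grad_H (V n)) < m \<and> H (V n) > H v0 + 2 * r"
      using small[OF m(1)] by (intro frequently_rev_mp[OF small[OF m(1)]]) (auto elim: eventually_mono)
    then obtain n where n: "H (V n) > H v0 + 2 * r" "norm (grad_H (V n)) < m"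
      by (auto dest: frequently_ex)
    then have "norm (V n - v0) < r" using m(2)[OF V, of n] by linarith
    then show False using n(1) H_lipschitz[of "V n" v0] by linarith
  qed
  then have "L \<le> H v0 + e" if "e > 0" for e
    using that half_gt_zero[OF that] by (metis field_sum_of_halves mult_2)
  then have "L \<le> H v0" by (rule field_le_epsilon)
  with \<open>H v0 \<le> L\<close> have L': "L = H v0" by simp
  show ?thesis
  proof (rule LIMSEQ_I)
    fix r :: real assume r: "r > 0"
    obtain m where m: "m > 0"
        "\<And>v. v \<in> centered \<Longrightarrow> r \<le> norm (v - v0) \<Longrightarrow> H v0 + m \<le> H v \<and> m \<le> norm (grad_H v)"
      using far_from_minimizer[OF v0 r] by blast
    have "\<forall>\<^sub>F n in sequentially. H (V n) < H v0 + m"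
      using L m(1) by (intro order_tendstoD) (auto simp: L')
    then obtain N where N: "\<And>n. n \<ge> N \<Longrightarrow> H (V n) < H v0 + m"
      unfolding eventually_sequentially by blast
    show "\<exists>no. \<forall>n\<ge>no. norm (V n - v0) < r"
    proof (intro exI allI impI)
      fix n assume "N \<le> n"
      then show "norm (V n - v0) < r" using N[of n] m(2)[OF V, of n] by linarith
    qed
  qed
qed

end

section \<open>Pathwise analysis of the Gauss-Newton recursion\<close>

lemma matrix_mult_matrix_inv:
  fixes A :: "real ^ 'n::finite ^ 'n"
  assumes "invertible A"
  shows "A *v (matrix_inv A *v x) = x"
proof -
  have "A ** matrix_inv A = mat 1"
    unfolding matrix_inv_def by (rule someI2_ex[OF assms[unfolded invertible_def]]) simp
  then show ?thesis by (simp add: matrix_vector_mul_assoc)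
qed

text \<open>
  The bound of \<open>A\<inverse>\<close> from below uses \<open>0 \<le> y \<bullet> (A *v y)\<close> for \<open>y = A\<inverse> x - x / L\<close>. Expanding it avoids
  square roots and eigenvectors of \<open>A\<close>, and gives \<open>1 / L\<close> instead of the weaker \<open>l / L\<^sup>2\<close> that follows
  from bounding \<open>norm (A *v z)\<close>.
\<close>
lemma
  fixes A :: "real ^ 'n::finite ^ 'n"
  assumes sym: "\<And>x y. x \<bullet> (A *v y) = (A *v x) \<bullet> y"
    and l: "0 < l" and lower: "\<And>x. l * (norm x)\<^sup>2 \<le> x \<bullet> (A *v x)"
    and L: "0 < L" and upper: "\<And>x. x \<bullet> (A *v x) \<le> L * (norm x)\<^sup>2"
  shows positive_definite_invertible: "invertible A"
    and norm_positive_definite_inverse: "norm (matrix_inv A *v x) \<le> norm x / l"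
    and inner_positive_definite_inverse: "(norm x)\<^sup>2 / L \<le> x \<bullet> (matrix_inv A *v x)"
proof -
  have "x = 0" if "A *v x = 0" for x
  proof -
    have "l * (norm x)\<^sup>2 \<le> 0" using lower[of x] that by simp
    then show ?thesis using l by (simp add: mult_le_0_iff)
  qed
  then show inv: "invertible A"
    by (simp add: invertible_left_inverse matrix_left_invertible_ker)
  define z where "z = matrix_inv A *v x"
  have Az: "A *v z = x" by (simp add: z_def matrix_mult_matrix_inv[OF inv])
  have "l * (norm z)\<^sup>2 \<le> z \<bullet> x" using lower[of z] by (simp add: Az)
  also have "\<dots> \<le> norm z * norm x" by (rule norm_cauchy_schwarz)
  finally have le: "norm z * (l * norm z) \<le> norm z * norm x"
    by (simp add: power2_eq_square mult.left_commute)
  have "l * norm z \<le> norm x"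
  proof (cases "norm z = 0")
    case False
    then show ?thesis using le by (simp add: mult_le_cancel_left_pos)
  qed simp
  then show "norm (matrix_inv A *v x) \<le> norm x / l"
    using l by (simp add: z_def[symmetric] field_simps)
  define y where "y = z - inverse L *\<^sub>R x"
  have "0 \<le> l * (norm y)\<^sup>2" using l by simp
  also have "\<dots> \<le> y \<bullet> (A *v y)" by (rule lower)
  also have "\<dots> = z \<bullet> x - 2 * inverse L * (x \<bullet> x) + inverse L * inverse L * (x \<bullet> (A *v x))"
    using sym[of z x] unfolding y_def
    by (simp add: matrix_vector_mult_diff_distrib matrix_vector_mult_scaleR inner_diff_left inner_diff_right Az inner_commute algebra_simps)
  also have "\<dots> \<le> z \<bullet> x - 2 * inverse L * (x \<bullet> x) + inverse L * inverse L * (L * (x \<bullet> x))"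
    using upper[of x] L by (intro add_left_mono mult_left_mono) (auto simp: power2_norm_eq_inner)
  also have "\<dots> = z \<bullet> x - (norm x)\<^sup>2 / L"
    using L by (simp add: power2_norm_eq_inner field_simps)
  finally show "(norm x)\<^sup>2 / L \<le> x \<bullet> (matrix_inv A *v x)"
    by (simp add: z_def inner_commute)
qed

text \<open>
  A sample path is a sequence \<open>p\<close> whose entry \<open>p 0\<close> is the starting point and whose entries
  \<open>p 1, p 2, \<dots>\<close> are the observed cost vectors.
\<close>
locale gauss_newton = semidiscrete_objective Q \<epsilon> w
  for Q :: "(real ^ 'j::finite) measure" and \<epsilon> w +
  fixes lab :: "nat \<Rightarrow> 'j" and \<alpha> \<beta> \<gamma> :: real
  assumes lab: "bij_betw lab {1..CARD('j)} UNIV"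
    and alpha: "0 \<le> \<alpha>" and beta: "0 < \<beta>" and gamma: "0 < \<gamma>"
    and alpha_beta: "\<alpha> + \<beta> < 1/2"
begin

abbreviation V :: "(nat \<Rightarrow> real ^ 'j) \<Rightarrow> nat \<Rightarrow> real ^ 'j" where
  "V p \<equiv> sgn_V g w lab \<alpha> \<beta> \<gamma> (p 0) p"

abbreviation S :: "(nat \<Rightarrow> real ^ 'j) \<Rightarrow> nat \<Rightarrow> real ^ 'j ^ 'j" where
  "S p \<equiv> sgn_S g w lab \<alpha> \<beta> \<gamma> (p 0) p"

text \<open>
  The period \<open>J\<close> is a parameter because \<open>CARD('j)\<close> would leave a type variable that the type of
  \<open>reg\<close> does not mention.
\<close>
abbreviation reg :: "nat \<Rightarrow> nat \<Rightarrow> real" where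
  "reg J n \<equiv> \<gamma> * (1 + real (n div J)) powr (- \<beta>)"

definition \<kappa> :: real where
  "\<kappa> = min 1 (\<gamma> * Min (range (\<lambda>j. w $ j))) / real CARD('j)"

text \<open>
  Lower and upper bounds for the eigenvalues of \<open>S p n\<close>.
\<close>
definition lower_ev :: "nat \<Rightarrow> real" where
  "lower_ev n = \<kappa> * real (Suc n) powr (1 - \<beta>)"

definition upper_ev :: "nat \<Rightarrow> real" where
  "upper_ev n = 1 + (4 + \<gamma>) * real n"

lemma w_le_1: "w $ j \<le> 1"
  using member_le_sum[of j UNIV "\<lambda>j. w $ j"] w_pos w_sum by (simp add: less_imp_le)

lemma Min_w: "0 < Min (range (\<lambda>j. w $ j))" "Min (range (\<lambda>j. w $ j)) \<le> w $ j"
  using w_pos by (auto intro: Min_le)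

lemma kappa_pos: "0 < \<kappa>"
  using Min_w(1) gamma by (simp add: \<kappa>_def)

lemma reg_nonneg: "0 \<le> reg CARD('j) n"
  using gamma by simp

lemma reg_le: "reg CARD('j) n \<le> \<gamma>"
  using gamma beta powr_mono2'[of "-\<beta>" 1 "1 + real (n div CARD('j))"] by simp

lemma Z_dir_inner: "Z_dir lab w (Suc k) \<bullet> x = sqrt (w $ lab (Suc (k mod CARD('j)))) * x $ lab (Suc (k mod CARD('j)))"
  by (simp add: Z_dir_def Let_def inner_axis')

lemma norm_Z_dir: "norm (Z_dir lab w k) \<le> 1"
  using w_le_1 w_pos by (simp add: Z_dir_def Let_def less_imp_le)

lemma S_eq_sum: "S p n = mat 1 + (\<Sum>k<n. outer_square (g (p (Suc k)) (V p k)))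
    + (\<Sum>k<n. reg CARD('j) (Suc k) *\<^sub>R outer_square (Z_dir lab w (Suc k)))"
  by (induction n) (simp_all add: algebra_simps)

lemma S_mult: "S p n *v x = x + (\<Sum>k<n. (g (p (Suc k)) (V p k) \<bullet> x) *\<^sub>R g (p (Suc k)) (V p k))
    + (\<Sum>k<n. (reg CARD('j) (Suc k) * (Z_dir lab w (Suc k) \<bullet> x)) *\<^sub>R Z_dir lab w (Suc k))"
  by (induction n)
     (simp_all add: matrix_vector_mult_add_rdistrib scaleR_matrix_vector_assoc[symmetric] outer_square_mult)

lemma S_symmetric: "x \<bullet> (S p n *v y) = (S p n *v x) \<bullet> y"
  by (simp add: S_mult inner_add_left inner_add_right inner_sum_left inner_sum_right inner_commute mult_ac)

lemma S_quadratic: "x \<bullet> (S p n *v x) = (norm x)\<^sup>2 + (\<Sum>k<n. (g (p (Suc k)) (V p k) \<bullet> x)\<^sup>2)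
    + (\<Sum>k<n. reg CARD('j) (Suc k) * (Z_dir lab w (Suc k) \<bullet> x)\<^sup>2)"
  unfolding power2_norm_eq_inner
  by (simp add: S_mult inner_add_right inner_sum_right power2_eq_square inner_commute mult_ac)

lemma S_upper: "x \<bullet> (S p n *v x) \<le> upper_ev n * (norm x)\<^sup>2"
proof -
  have "(g (p (Suc k)) (V p k) \<bullet> x)\<^sup>2 \<le> 4 * (norm x)\<^sup>2" for k
  proof -
    have "\<bar>g (p (Suc k)) (V p k) \<bullet> x\<bar> \<le> 2 * norm x"
      using Cauchy_Schwarz_ineq2[of "g (p (Suc k)) (V p k)" x] mult_right_mono[OF norm_g, of "norm x"]
      by (meson norm_ge_zero order_trans)
    from power_mono[OF this, of 2] show ?thesis by (simp add: power_mult_distrib)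
  qed
  then have 1: "(\<Sum>k<n. (g (p (Suc k)) (V p k) \<bullet> x)\<^sup>2) \<le> (\<Sum>k<n. 4 * (norm x)\<^sup>2)"
    by (intro sum_mono)
  have "reg CARD('j) (Suc k) * (Z_dir lab w (Suc k) \<bullet> x)\<^sup>2 \<le> \<gamma> * (norm x)\<^sup>2" for k
  proof (intro mult_mono reg_le)
    have "\<bar>Z_dir lab w (Suc k) \<bullet> x\<bar> \<le> 1 * norm x"
      using Cauchy_Schwarz_ineq2[of "Z_dir lab w (Suc k)" x] mult_right_mono[OF norm_Z_dir, of "norm x"]
      by (meson norm_ge_zero order_trans)
    from power_mono[OF this, of 2] show "(Z_dir lab w (Suc k) \<bullet> x)\<^sup>2 \<le> (norm x)\<^sup>2" by simp
  qed (use gamma in auto)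
  then have 2: "(\<Sum>k<n. reg CARD('j) (Suc k) * (Z_dir lab w (Suc k) \<bullet> x)\<^sup>2) \<le> (\<Sum>k<n. \<gamma> * (norm x)\<^sup>2)"
    by (intro sum_mono)
  show ?thesis using 1 2 unfolding S_quadratic upper_ev_def by (simp add: algebra_simps)
qed

text \<open>
  Every complete period of the cyclic enumeration contributes the full squared norm.
\<close>
lemma cyclic_sum_squares: "real (n div CARD('j)) * (norm x)\<^sup>2 \<le> (\<Sum>k<n. (x $ lab (Suc (k mod CARD('j))))\<^sup>2)"
proof -
  let ?J = "CARD('j)" and ?f = "\<lambda>k. (x $ lab (Suc (k mod CARD('j))))\<^sup>2"
  have period: "(\<Sum>k=m*?J..<m*?J+?J. ?f k) = (norm x)\<^sup>2" for m
  proof -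
    have "(\<Sum>k=m*?J..<m*?J+?J. ?f k) = (\<Sum>k=0..<?J. ?f (k + m*?J))"
      using sum.shift_bounds_nat_ivl[of ?f 0 "m*?J" ?J] by (simp add: add.commute)
    also have "\<dots> = (\<Sum>k=0..<?J. (x $ lab (Suc k))\<^sup>2)"
      by (intro sum.cong) simp_all
    also have "\<dots> = (\<Sum>i=1..?J. (x $ lab i)\<^sup>2)"
      using sum.shift_bounds_Suc_ivl[of "\<lambda>i. (x $ lab i)\<^sup>2" 0 ?J] by (simp add: atLeastLessThanSuc_atLeastAtMost)
    also have "\<dots> = (\<Sum>j\<in>UNIV. (x $ j)\<^sup>2)"
      by (rule sum.reindex_bij_betw[OF lab])
    also have "\<dots> = (norm x)\<^sup>2"
      unfolding power2_norm_eq_inner by (simp add: inner_vec_def power2_eq_square)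
    finally show ?thesis .
  qed
  have "real (n div ?J) * (norm x)\<^sup>2 = (\<Sum>m<n div ?J. \<Sum>k=m*?J..<m*?J+?J. ?f k)"
    unfolding period by simp
  also have "\<dots> = (\<Sum>k<n div ?J * ?J. ?f k)" by (rule sum.nat_group)
  also have "\<dots> \<le> (\<Sum>k<n. ?f k)"
    by (intro sum_mono2) (auto intro: less_le_trans[OF _ div_times_less_eq_dividend])
  finally show ?thesis .
qed

text \<open>
  The factors \<open>(1 + \<lfloor>k/J\<rfloor>)\<^bsup>-\<beta>\<^esup>\<close> with \<open>k \<le> n\<close> are at least \<open>(1 + n)\<^bsup>-\<beta>\<^esup>\<close>, and \<open>\<lfloor>n / J\<rfloor>\<close> periods are complete, so the
  regularization contributes a multiple of \<open>(1 + n)\<^bsup>-\<beta>\<^esup> \<lfloor>n / J\<rfloor>\<close>.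
\<close>
lemma S_lower: "lower_ev n * (norm x)\<^sup>2 \<le> x \<bullet> (S p n *v x)"
proof -
  let ?J = "real CARD('j)"
  define m where "m = Min (range (\<lambda>j. w $ j))"
  define \<rho> where "\<rho> = real (Suc n) powr (- \<beta>)"
  define \<kappa>' where "\<kappa>' = min 1 (\<gamma> * m)"
  have m: "0 < m" "\<And>j. m \<le> w $ j" using Min_w by (auto simp: m_def)
  have \<rho>: "0 < \<rho>" "\<rho> \<le> 1" using beta powr_mono2'[of "-\<beta>" 1 "real (Suc n)"] by (auto simp: \<rho>_def)
  have \<kappa>': "0 < \<kappa>'" "\<kappa>' \<le> 1" "\<kappa>' \<le> \<gamma> * m" using m gamma by (auto simp: \<kappa>'_def)
  have coordinate: "\<kappa>' * \<rho> * (x $ lab (Suc (k mod CARD('j))))\<^sup>2 \<le> reg CARD('j) (Suc k) * (Z_dir lab w (Suc k) \<bullet> x)\<^sup>2"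
    if k: "k < n" for k
  proof -
    have "Suc k div CARD('j) \<le> n" using k div_le_dividend[of "Suc k" "CARD('j)"] by linarith
    then have "\<rho> \<le> (1 + real (Suc k div CARD('j))) powr (- \<beta>)"
      unfolding \<rho>_def using beta by (intro powr_mono2') auto
    then have "\<kappa>' * \<rho> \<le> (\<gamma> * m) * (1 + real (Suc k div CARD('j))) powr (- \<beta>)"
      using \<kappa>' \<rho> m gamma by (intro mult_mono) auto
    also have "\<dots> \<le> reg CARD('j) (Suc k) * w $ lab (Suc (k mod CARD('j)))"
      using mult_left_mono[OF m(2)[of "lab (Suc (k mod CARD('j)))"] reg_nonneg[of "Suc k"]] by (simp add: mult_ac)
    finally have "\<kappa>' * \<rho> * (x $ lab (Suc (k mod CARD('j))))\<^sup>2
        \<le> reg CARD('j) (Suc k) * w $ lab (Suc (k mod CARD('j))) * (x $ lab (Suc (k mod CARD('j))))\<^sup>2"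
      by (intro mult_right_mono) auto
    then show ?thesis using w_pos by (simp add: Z_dir_inner power_mult_distrib less_imp_le mult_ac)
  qed
  have J: "0 < ?J" by simp
  have "real n + 1 \<le> ?J * real (n div CARD('j)) + ?J"
  proof -
    have "n + 1 \<le> CARD('j) * (n div CARD('j)) + CARD('j)"
      using mod_less_divisor[of "CARD('j)" n] mult_div_mod_eq[of "CARD('j)" n] by (metis Suc_eq_plus1 Suc_leI add_less_cancel_left zero_less_card_finite)
    then show ?thesis by (metis of_nat_1 of_nat_add of_nat_le_iff of_nat_mult)
  qed
  then have div: "real (Suc n) / ?J - 1 \<le> real (n div CARD('j))" using J by (simp add: field_simps)
  have "\<rho> * real (Suc n) = real (Suc n) powr (1 - \<beta>)"
    unfolding \<rho>_def by (simp add: powr_diff powr_minus field_simps)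
  then have "lower_ev n = \<kappa>' * \<rho> * (real (Suc n) / ?J)"
    unfolding lower_ev_def \<kappa>_def \<kappa>'_def m_def by (simp only: times_divide_eq_left times_divide_eq_right mult.assoc)
  (* The identity matrix S 0 compensates the period lost by rounding n / J down. This is why \<kappa>' is
     capped at 1, and it makes the bound valid from n = 0 on. *)
  also have "\<dots> \<le> 1 + \<kappa>' * \<rho> * (real (Suc n) / ?J - 1)"
    using mult_mono[of \<kappa>' 1 \<rho> 1] \<kappa>' \<rho> by (simp add: algebra_simps)
  also have "\<dots> \<le> 1 + \<kappa>' * \<rho> * real (n div CARD('j))"
    using div \<kappa>' \<rho> by (intro add_left_mono mult_left_mono) auto
  finally have "lower_ev n * (norm x)\<^sup>2 \<le> (1 + \<kappa>' * \<rho> * real (n div CARD('j))) * (norm x)\<^sup>2"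
    by (intro mult_right_mono) auto
  also have "\<dots> = (norm x)\<^sup>2 + \<kappa>' * \<rho> * (real (n div CARD('j)) * (norm x)\<^sup>2)"
    by (simp add: algebra_simps)
  also have "\<dots> \<le> (norm x)\<^sup>2 + \<kappa>' * \<rho> * (\<Sum>k<n. (x $ lab (Suc (k mod CARD('j))))\<^sup>2)"
    using cyclic_sum_squares \<kappa>' \<rho> by (intro add_left_mono mult_left_mono) auto
  also have "\<dots> \<le> (norm x)\<^sup>2 + (\<Sum>k<n. reg CARD('j) (Suc k) * (Z_dir lab w (Suc k) \<bullet> x)\<^sup>2)"
    unfolding sum_distrib_left by (intro add_left_mono sum_mono coordinate) auto
  also have "\<dots> \<le> x \<bullet> (S p n *v x)"
    unfolding S_quadratic by (simp add: sum_nonneg)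
  finally show ?thesis .
qed

lemma lower_ev_pos: "0 < lower_ev n"
  using kappa_pos by (simp add: lower_ev_def)

lemma upper_ev_pos: "0 < upper_ev n"
  using gamma by (simp add: upper_ev_def add_pos_nonneg)

lemma S_invertible: "invertible (S p n)"
  by (rule positive_definite_invertible[where A = "S p n", OF S_symmetric lower_ev_pos S_lower upper_ev_pos S_upper])

lemma norm_S_inverse: "norm (matrix_inv (S p n) *v x) \<le> norm x / lower_ev n"
  by (rule norm_positive_definite_inverse[where A = "S p n", OF S_symmetric lower_ev_pos S_lower upper_ev_pos S_upper])

lemma inner_S_inverse: "(norm x)\<^sup>2 / upper_ev n \<le> x \<bullet> (matrix_inv (S p n) *v x)"
  by (rule inner_positive_definite_inverse[where A = "S p n", OF S_symmetric lower_ev_pos S_lower upper_ev_pos S_upper])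

lemma V_centered: "p 0 \<in> centered \<Longrightarrow> V p n \<in> centered"
  by (cases n) (simp_all add: proj_mat_centered)

lemma grad_H_centered: "grad_H v \<in> centered"
  by (simp add: centered_iff grad_H_sum)

text \<open>
  Up to a constant, a bound for the length of one step: the factor \<open>n\<^sup>\<alpha>\<close> divided by \<open>lower_ev n\<close>.
\<close>
definition rate :: "nat \<Rightarrow> real" where
  "rate n = real (Suc n) powr (\<alpha> + \<beta> - 1) / \<kappa>"

lemma step_pow_nonneg: "0 \<le> step_pow \<alpha> n"
  by (simp add: step_pow_def)

lemma step_pow_ge_1: "1 \<le> n \<Longrightarrow> 1 \<le> step_pow \<alpha> n"
  using alpha powr_mono2[of \<alpha> 1 "real n"] by (simp add: step_pow_def)

lemma step_le_rate: "step_pow \<alpha> n / lower_ev n \<le> rate n"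
proof -
  have "step_pow \<alpha> n \<le> real (Suc n) powr \<alpha>"
    using alpha powr_mono2[of \<alpha> "real n" "real (Suc n)"] by (auto simp: step_pow_def)
  then have "step_pow \<alpha> n / lower_ev n \<le> real (Suc n) powr \<alpha> / lower_ev n"
    using lower_ev_pos[of n] by (intro divide_right_mono) auto
  also have "\<dots> = rate n"
    by (simp add: lower_ev_def rate_def powr_diff powr_add field_simps)
  finally show ?thesis .
qed

lemma summable_rate_squared: "summable (\<lambda>n. (rate n)\<^sup>2)"
proof -
  have "summable (\<lambda>n. real n powr (2 * (\<alpha> + \<beta> - 1)))"
    using alpha_beta by (simp add: summable_real_powr_iff)
  then have "summable (\<lambda>n. real (Suc n) powr (2 * (\<alpha> + \<beta> - 1)) / \<kappa>\<^sup>2)"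
    by (intro summable_divide) (subst summable_Suc_iff[where f = "\<lambda>n. real n powr (2 * (\<alpha> + \<beta> - 1))"])
  then show ?thesis
    by (simp add: rate_def power_divide powr_power mult.commute)
qed

text \<open>
  As \<open>\<alpha> \<ge> 0\<close> and the eigenvalues of \<open>S\<close> grow at most linearly, the drift dominates the harmonic
  series.
\<close>
lemma not_summable_drift: "\<not> summable (\<lambda>n. step_pow \<alpha> n / upper_ev n)"
proof
  assume s: "summable (\<lambda>n. step_pow \<alpha> n / upper_ev n)"
  have "summable (\<lambda>n. inverse (real n) / (5 + \<gamma>))"
  proof (rule summable_comparison_test_ev[OF _ s])
    show "\<forall>\<^sub>F n in sequentially. norm (inverse (real n) / (5 + \<gamma>)) \<le> step_pow \<alpha> n / upper_ev n"
      using eventually_ge_at_top[of "1::nat"]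
    proof eventually_elim
      case (elim n)
      have "upper_ev n \<le> (5 + \<gamma>) * real n" using elim gamma by (simp add: upper_ev_def algebra_simps)
      then have "1 / ((5 + \<gamma>) * real n) \<le> step_pow \<alpha> n / upper_ev n"
        using step_pow_ge_1[OF elim] upper_ev_pos[of n] elim gamma by (intro frac_le) auto
      then show ?case using elim gamma by (simp add: field_simps)
    qed
  qed
  from summable_mult[OF this, of "5 + \<gamma>"] have "summable (\<lambda>n. inverse (real n))"
    using gamma by simp
  then show False using not_summable_harmonic[where 'a = real] by simp
qed

text \<open>
  The noise is a function of the path \<open>p\<close>, through the state at time \<open>n\<close>, and of a separate
  observation \<open>z\<close>; the algorithm uses \<open>z = p (n + 1)\<close>. Keeping \<open>z\<close> separate allows it to be integrated
  out.
\<close>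
definition noise :: "nat \<Rightarrow> (nat \<Rightarrow> real ^ 'j) \<Rightarrow> real ^ 'j \<Rightarrow> real" where
  "noise n p z = step_pow \<alpha> n * (grad_H (V p n) \<bullet> (matrix_inv (S p n) *v (g z (V p n) - grad_H (V p n))))"

lemma noise_bound: "\<bar>noise n p z\<bar> \<le> 8 * rate n"
proof -
  let ?v = "V p n"
  have "norm (g z ?v - grad_H ?v) \<le> 4"
    using norm_triangle_ineq4[of "g z ?v" "grad_H ?v"] norm_g[of z ?v] norm_grad_H[of ?v] by linarith
  then have "norm (matrix_inv (S p n) *v (g z ?v - grad_H ?v)) \<le> 4 / lower_ev n"
    using norm_S_inverse[of p n "g z ?v - grad_H ?v"] lower_ev_pos[of n]
    by (meson divide_right_mono less_imp_le order_trans)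
  then have "norm (grad_H ?v) * norm (matrix_inv (S p n) *v (g z ?v - grad_H ?v)) \<le> 2 * (4 / lower_ev n)"
    by (intro mult_mono norm_grad_H) auto
  then have "\<bar>grad_H ?v \<bullet> (matrix_inv (S p n) *v (g z ?v - grad_H ?v))\<bar> \<le> 8 / lower_ev n"
    using Cauchy_Schwarz_ineq2[of "grad_H ?v" "matrix_inv (S p n) *v (g z ?v - grad_H ?v)"] by simp
  then have "\<bar>noise n p z\<bar> \<le> step_pow \<alpha> n * (8 / lower_ev n)"
    unfolding noise_def abs_mult abs_of_nonneg[OF step_pow_nonneg] by (rule mult_left_mono[OF _ step_pow_nonneg])
  also have "\<dots> = 8 * (step_pow \<alpha> n / lower_ev n)" by simp
  also have "\<dots> \<le> 8 * rate n" by (intro mult_left_mono step_le_rate) simp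
  finally show ?thesis .
qed

lemma noise_mean_zero: "(\<integral>z. noise n p z \<partial>Q) = 0"
proof -
  define y where "y = grad_H (V p n) v* matrix_inv (S p n)"
  have "noise n p z = step_pow \<alpha> n * (g z (V p n) \<bullet> y - grad_H (V p n) \<bullet> y)" for z
    unfolding noise_def y_def dot_lmul_matrix[symmetric] by (simp add: inner_diff_right inner_commute)
  then show ?thesis by (simp add: integrable_g_inner grad_H_inner[symmetric] prob_space)
qed

lemma descent:
  assumes "p 0 \<in> centered"
  shows "H (V p (Suc n)) \<le> H (V p n) - step_pow \<alpha> n / upper_ev n * (norm (grad_H (V p n)))\<^sup>2
    - noise n p (p (Suc n)) + 8 / \<epsilon> * (rate n)\<^sup>2"
proof -
  define v a b where "v = V p n" and "a = step_pow \<alpha> n" and "b = grad_H v"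
  define u where "u = matrix_inv (S p n) *v g (p (Suc n)) v"
  have step: "V p (Suc n) - v = - (a *\<^sub>R (proj_mat *v u))"
    using proj_mat_fixes_centered[OF V_centered[of p, OF assms], of n]
    by (simp add: v_def a_def u_def matrix_vector_mult_diff_distrib matrix_vector_mult_scaleR)
  have "norm u \<le> 2 / lower_ev n"
    unfolding u_def using norm_S_inverse[of p n "g (p (Suc n)) v"] norm_g lower_ev_pos[of n]
    by (meson divide_right_mono less_imp_le order_trans)
  then have "a * norm (proj_mat *v u) \<le> a * (2 / lower_ev n)"
    using norm_proj_mat_le[of u] step_pow_nonneg by (intro mult_left_mono) (auto simp: a_def)
  also have "\<dots> = 2 * (step_pow \<alpha> n / lower_ev n)" by (simp add: a_def)
  also have "\<dots> \<le> 2 * rate n" by (intro mult_left_mono step_le_rate) simp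
  finally have "norm (V p (Suc n) - v) \<le> 2 * rate n"
    unfolding step using step_pow_nonneg[of n] by (simp add: a_def)
  then have "(norm (V p (Suc n) - v))\<^sup>2 \<le> (2 * rate n)\<^sup>2" by (intro power_mono) auto
  then have quad: "2 / \<epsilon> * (norm (V p (Suc n) - v))\<^sup>2 \<le> 2 / \<epsilon> * (2 * rate n)\<^sup>2"
    using eps by (intro mult_left_mono) auto
  have "b \<bullet> (V p (Suc n) - v) = - a * (b \<bullet> u)"
    unfolding step using inner_proj_mat[OF grad_H_centered[of v], of u] by (simp add: b_def)
  moreover have "a * (b \<bullet> u) = a * (b \<bullet> (matrix_inv (S p n) *v b)) + noise n p (p (Suc n))"
    by (simp add: u_def noise_def a_def b_def v_def matrix_vector_mult_diff_distrib inner_diff_right algebra_simps)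
  moreover have "a * ((norm b)\<^sup>2 / upper_ev n) \<le> a * (b \<bullet> (matrix_inv (S p n) *v b))"
    using inner_S_inverse[of b n p] step_pow_nonneg by (intro mult_left_mono) (auto simp: a_def)
  ultimately have "b \<bullet> (V p (Suc n) - v) \<le> - (a / upper_ev n * (norm b)\<^sup>2) - noise n p (p (Suc n))"
    by simp
  then show ?thesis
    using H_smooth[of "V p (Suc n)" v] quad unfolding b_def[symmetric] v_def[symmetric] a_def[symmetric]
    by (simp add: power_mult_distrib)
qed

theorem V_converges:
  assumes p0: "p 0 \<in> centered"
    and v0: "v0 \<in> centered" "\<And>u. u \<in> centered \<Longrightarrow> H v0 \<le> H u"
    and noise: "summable (\<lambda>n. noise n p (p (Suc n)))"
  shows "V p \<longlonglongrightarrow> v0"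
proof -
  let ?drift = "\<lambda>n. step_pow \<alpha> n / upper_ev n * (norm (grad_H (V p n)))\<^sup>2"
  have sb: "summable (\<lambda>n. 8 / \<epsilon> * (rate n)\<^sup>2)" by (intro summable_mult summable_rate_squared)
  have nonneg: "0 \<le> H (V p n) - H v0" for n using v0(2)[OF V_centered[of p, OF p0]] by simp
  have drift: "0 \<le> ?drift n" for n using step_pow_nonneg upper_ev_pos[of n] by simp
  have step: "H (V p (Suc n)) - H v0 \<le> (H (V p n) - H v0) - ?drift n - noise n p (p (Suc n)) + 8 / \<epsilon> * (rate n)\<^sup>2" for n
    using descent[of p n, OF p0] by linarith
  note conv = convergent_descent[where h = "\<lambda>n. H (V p n) - H v0", OF nonneg drift step noise sb]
  show ?thesis
  proof (rule converges_to_minimizer[OF v0 V_centered[of p, OF p0]])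
    show "convergent (\<lambda>n. H (V p n))"
      using conv(1) by (simp add: convergent_diff_const_right_iff)
    fix \<delta> :: real assume \<delta>: "\<delta> > 0"
    show "\<exists>\<^sub>F n in sequentially. norm (grad_H (V p n)) < \<delta>"
    proof (rule ccontr)
      assume "\<not> ?thesis"
      then have "\<forall>\<^sub>F n in sequentially. \<delta> \<le> norm (grad_H (V p n))"
        by (simp add: not_frequently not_less)
      then have "\<forall>\<^sub>F n in sequentially. norm (step_pow \<alpha> n / upper_ev n * \<delta>\<^sup>2) \<le> ?drift n"
      proof eventually_elim
        case (elim n)
        then have "\<delta>\<^sup>2 \<le> (norm (grad_H (V p n)))\<^sup>2" using \<delta> by (intro power_mono) auto
        then show ?case
          using mult_left_mono[of "\<delta>\<^sup>2" _ "step_pow \<alpha> n / upper_ev n"] step_pow_nonneg[of n] upper_ev_pos[of n]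
          by simp
      qed
      then have "summable (\<lambda>n. step_pow \<alpha> n / upper_ev n * \<delta>\<^sup>2)"
        by (rule summable_comparison_test_ev[OF _ conv(2)])
      from summable_mult2[OF this, of "1 / \<delta>\<^sup>2"] show False
        using \<delta> not_summable_drift by simp
    qed
  qed
qed

text \<open>
  The weight \<open>1 / (n + 1)\<close> is the one required by Kronecker's lemma.
\<close>
definition moment_noise :: "'j \<Rightarrow> 'j \<Rightarrow> nat \<Rightarrow> (nat \<Rightarrow> real ^ 'j) \<Rightarrow> real ^ 'j \<Rightarrow> real" where
  "moment_noise i j n p z = (outer_square (g z (V p n)) - G (V p n)) $ i $ j / real (Suc n)"

lemma outer_square_g_bound: "norm (outer_square (g z v)) \<le> 4"
  using power_mono[OF norm_g, of _ _ 2] by (auto simp: norm_outer_square)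

lemma integrable_outer_square: "integrable Q (\<lambda>z. outer_square (g z v))"
  by (rule integrable_const_bound[of _ 4]) (auto simp: outer_square_g_bound outer_square_g_measurable)

lemma norm_component_le: "\<bar>A $ i $ j\<bar> \<le> norm A" for A :: "real ^ 'j ^ 'j"
  using component_le_norm_cart[of "A $ i" j] Finite_Cartesian_Product.norm_nth_le[of A i] by linarith

lemma norm_G: "norm (G v) \<le> 4"
proof -
  have "norm (G v) \<le> (\<integral>z. norm (outer_square (g z v)) \<partial>Q)" unfolding G_eps_def by (rule integral_norm_bound)
  also have "\<dots> \<le> (\<integral>z. 4 \<partial>Q)"
    by (intro integral_mono integrable_norm integrable_outer_square outer_square_g_bound) auto
  finally show ?thesis by (simp add: prob_space)
qed

lemma moment_noise_bound: "\<bar>moment_noise i j n p z\<bar> \<le> 8 / real (Suc n)"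
proof -
  have "norm (outer_square (g z (V p n)) - G (V p n)) \<le> 8"
    using norm_triangle_ineq4[of "outer_square (g z (V p n))" "G (V p n)"] outer_square_g_bound[of z "V p n"] norm_G[of "V p n"]
    by linarith
  then have "\<bar>(outer_square (g z (V p n)) - G (V p n)) $ i $ j\<bar> \<le> 8"
    using norm_component_le order_trans by blast
  then show ?thesis unfolding moment_noise_def abs_divide by (simp add: divide_right_mono)
qed

lemma moment_noise_mean_zero: "(\<integral>z. moment_noise i j n p z \<partial>Q) = 0"
proof -
  have bl: "bounded_linear (\<lambda>A :: real ^ 'j ^ 'j. A $ i $ j)"
    by (intro bounded_linear_compose[OF bounded_linear_vec_nth] bounded_linear_vec_nth)
  have "G (V p n) $ i $ j = (\<integral>z. outer_square (g z (V p n)) $ i $ j \<partial>Q)"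
    unfolding G_eps_def by (rule integral_bounded_linear[OF bl integrable_outer_square, symmetric])
  moreover have "integrable Q (\<lambda>z. outer_square (g z (V p n)) $ i $ j)"
    by (rule integrable_bounded_linear[OF bl integrable_outer_square])
  ultimately show ?thesis by (simp add: moment_noise_def prob_space)
qed

text \<open>
  Of the four averages that make up \<open>S\<^sub>n / n\<close>, only that of \<open>G\<close> along the trajectory survives; the
  regularization fades because its weights tend to \<open>0\<close>.
\<close>
theorem S_mean_converges:
  assumes V: "V p \<longlonglongrightarrow> v0"
    and noise: "\<And>i j. summable (\<lambda>n. moment_noise i j n p (p (Suc n)))"
  shows "(\<lambda>n. (1 / real n) *\<^sub>R S p n) \<longlonglongrightarrow> G v0"
proof -
  let ?O = "\<lambda>k. outer_square (g (p (Suc k)) (V p k))"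
  let ?R = "\<lambda>k. reg CARD('j) (Suc k) *\<^sub>R outer_square (Z_dir lab w (Suc k))"
  have 1: "(\<lambda>n. (1 / real n) *\<^sub>R (mat 1 :: real ^ 'j ^ 'j)) \<longlonglongrightarrow> 0"
    using tendsto_scaleR[OF lim_1_over_n tendsto_const[of "mat 1 :: real ^ 'j ^ 'j"]] by simp
  have 2: "(\<lambda>n. (1 / real n) *\<^sub>R (\<Sum>k<n. ?O k - G (V p k))) \<longlonglongrightarrow> 0"
  proof (intro vec_tendstoI)
    fix i j
    have "(\<lambda>n. (\<Sum>k<n. (?O k - G (V p k)) $ i $ j) / real n) \<longlonglongrightarrow> 0"
      using noise[of i j] by (intro kronecker_mean) (simp add: moment_noise_def)
    then show "(\<lambda>n. ((1 / real n) *\<^sub>R (\<Sum>k<n. ?O k - G (V p k))) $ i $ j) \<longlonglongrightarrow> (0 :: real ^ 'j ^ 'j) $ i $ j"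
      by (simp add: sum_component)
  qed
  have 3: "(\<lambda>n. (1 / real n) *\<^sub>R (\<Sum>k<n. G (V p k))) \<longlonglongrightarrow> G v0"
    by (rule cesaro_mean[OF tendsto_G[OF V]])
  have "reg CARD('j) \<longlonglongrightarrow> 0"
  proof -
    have "filterlim (\<lambda>n. n div CARD('j)) at_top sequentially"
      by (rule filterlim_at_top_div_const_nat) simp
    then have "filterlim (\<lambda>n. real (n div CARD('j))) at_top sequentially"
      by (rule filterlim_compose[OF filterlim_real_sequentially])
    then have "filterlim (\<lambda>n. 1 + real (n div CARD('j))) at_top sequentially"
      by (rule filterlim_tendsto_add_at_top[OF tendsto_const])
    then have "((\<lambda>n. (1 + real (n div CARD('j))) powr (- \<beta>)) \<longlongrightarrow> 0) sequentially"
      using beta by (intro tendsto_neg_powr) auto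
    from tendsto_mult_right_zero[OF this, of \<gamma>] show ?thesis .
  qed
  then have r: "(\<lambda>k. reg CARD('j) (Suc k)) \<longlonglongrightarrow> 0" by (rule LIMSEQ_Suc)
  have "?R \<longlonglongrightarrow> 0"
  proof (rule Lim_null_comparison[OF _ r])
    have "norm (?R k) \<le> reg CARD('j) (Suc k) * 1" for k
      using reg_nonneg[of "Suc k"] power_mono[OF norm_Z_dir[of "Suc k"], of 2]
      by (simp add: norm_outer_square mult_left_le)
    then show "\<forall>\<^sub>F k in sequentially. norm (?R k) \<le> reg CARD('j) (Suc k)" by simp
  qed
  from cesaro_mean[OF this] have 4: "(\<lambda>n. (1 / real n) *\<^sub>R (\<Sum>k<n. ?R k)) \<longlonglongrightarrow> 0" .
  have "(1 / real n) *\<^sub>R S p n = (1 / real n) *\<^sub>R mat 1 + (1 / real n) *\<^sub>R (\<Sum>k<n. ?O k - G (V p k))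
      + (1 / real n) *\<^sub>R (\<Sum>k<n. G (V p k)) + (1 / real n) *\<^sub>R (\<Sum>k<n. ?R k)" for n
    unfolding S_eq_sum scaleR_add_right[symmetric] by (simp add: sum_subtractf)
  then show ?thesis
    using tendsto_add[OF tendsto_add[OF tendsto_add[OF 1 2] 3] 4] by simp
qed

end

section \<open>Measurability and almost sure convergence\<close>

lemma borel_measurable_vec_nth:
  fixes f :: "'a \<Rightarrow> 'b::real_normed_vector ^ 'n::finite"
  assumes "f \<in> borel_measurable M"
  shows "(\<lambda>x. f x $ i) \<in> borel_measurable M"
  by (rule measurable_compose[OF assms borel_measurable_continuous_onI]) (intro continuous_intros)

lemma borel_measurable_vec:
  fixes f :: "'a \<Rightarrow> real ^ 'n::finite"
  assumes "\<And>i. (\<lambda>x. f x $ i) \<in> borel_measurable M"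
  shows "f \<in> borel_measurable M"
  unfolding borel_measurable_euclidean_space[of f]
  using assms by (auto simp: Basis_vec_def inner_axis)

lemma borel_measurable_det:
  fixes A :: "'a \<Rightarrow> real ^ 'n::finite ^ 'n"
  assumes "\<And>i j. (\<lambda>x. A x $ i $ j) \<in> borel_measurable M"
  shows "(\<lambda>x. det (A x)) \<in> borel_measurable M"
  unfolding det_def by (intro borel_measurable_sum borel_measurable_times borel_measurable_prod borel_measurable_const assms)

lemma borel_measurable_matrix_vector_mult:
  fixes A :: "'a \<Rightarrow> real ^ 'n::finite ^ 'm::finite"
  assumes "A \<in> borel_measurable M" "b \<in> borel_measurable M"
  shows "(\<lambda>x. A x *v b x) \<in> borel_measurable M"
  by (intro borel_measurable_vec)
     (auto simp: matrix_vector_mult_def intro!: borel_measurable_sum borel_measurable_times borel_measurable_vec_nth assms)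

text \<open>
  Cramer's rule is the route to measurability: \<open>matrix_inv\<close> is defined by a choice operator, but its
  values on invertible matrices are quotients of polynomials in the entries.
\<close>
lemma matrix_inv_mult_cramer:
  fixes A :: "real ^ 'n::finite ^ 'n"
  assumes "invertible A"
  shows "matrix_inv A *v b = (\<chi> k. det (\<chi> i j. if j = k then b $ i else A $ i $ j) / det A)"
  using cramer[of A] matrix_mult_matrix_inv[OF assms] assms by (simp add: invertible_det_nz)

lemma borel_measurable_matrix_inv_mult:
  fixes A :: "'a \<Rightarrow> real ^ 'n::finite ^ 'n"
  assumes A: "A \<in> borel_measurable M" and b: "b \<in> borel_measurable M" and inv: "\<And>x. invertible (A x)"
  shows "(\<lambda>x. matrix_inv (A x) *v b x) \<in> borel_measurable M"
proof (rule borel_measurable_vec)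
  fix k
  have "(\<lambda>x. if j = k then b x $ i else A x $ i $ j) \<in> borel_measurable M" for i j
    using A b by (cases "j = k") (auto intro!: borel_measurable_vec_nth)
  then have "(\<lambda>x. det (\<chi> i j. if j = k then b x $ i else A x $ i $ j) / det (A x)) \<in> borel_measurable M"
    by (intro borel_measurable_divide borel_measurable_det) (auto intro!: borel_measurable_vec_nth A)
  then show "(\<lambda>x. (matrix_inv (A x) *v b x) $ k) \<in> borel_measurable M"
    by (simp add: matrix_inv_mult_cramer[OF inv])
qed

context gauss_newton
begin

lemma measurable_g_compose:
  "f \<in> borel_measurable N \<Longrightarrow> u \<in> borel_measurable N \<Longrightarrow> (\<lambda>x. g (f x) (u x)) \<in> borel_measurable N"
  using measurable_compose[OF measurable_Pair measurable_g] by simp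

lemma measurable_outer_square:
  "f \<in> borel_measurable N \<Longrightarrow> (\<lambda>x. outer_square (f x) :: real ^ 'j ^ 'j) \<in> borel_measurable N"
  by (rule measurable_compose[OF _ borel_measurable_continuous_onI[OF continuous_outer_square]])

text \<open>
  The state at time \<open>n\<close> as a function on paths up to time \<open>m \<ge> n\<close>. The bound \<open>m\<close> stays fixed in the
  induction, so that all earlier states are functions on the same space.
\<close>
lemma measurable_V_S:
  assumes "n \<le> m"
  shows "(\<lambda>p. V p n) \<in> borel_measurable (Pi\<^sub>M {..m} (\<lambda>_. borel)) \<and>
         (\<lambda>p. S p n) \<in> borel_measurable (Pi\<^sub>M {..m} (\<lambda>_. borel))"
  using assms
proof (induction n)
  case 0
  then show ?case by (auto intro!: measurable_component_singleton)
next
  case (Suc n)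
  from Suc.prems have "n \<le> m" by simp
  note V = Suc.IH[OF this, THEN conjunct1] and S = Suc.IH[OF this, THEN conjunct2]
  have p: "(\<lambda>p. p (Suc n)) \<in> borel_measurable (Pi\<^sub>M {..m} (\<lambda>_. borel))"
    using Suc.prems by (intro measurable_component_singleton) auto
  note gm = measurable_g_compose[OF p V]
  show ?case
    unfolding sgn_V.simps sgn_S.simps
    by (intro conjI borel_measurable_matrix_vector_mult borel_measurable_diff borel_measurable_scaleR
        borel_measurable_add borel_measurable_const borel_measurable_matrix_inv_mult S_invertible V S gm measurable_outer_square)
qed

text \<open>
  The algorithm is non-anticipating.
\<close>
lemma V_S_restrict:
  "n \<le> m \<Longrightarrow> V (restrict p {..m}) n = V p n \<and> S (restrict p {..m}) n = S p n"
  by (induction n) auto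

lemma noise_restrict: "noise n (restrict p {..n}) z = noise n p z"
  unfolding noise_def V_S_restrict[OF order_refl, THEN conjunct1] V_S_restrict[OF order_refl, THEN conjunct2] ..

lemma moment_noise_restrict: "moment_noise i j n (restrict p {..n}) z = moment_noise i j n p z"
  unfolding moment_noise_def V_S_restrict[OF order_refl, THEN conjunct1] ..

lemma measurable_grad_H: "grad_H \<in> borel_measurable borel"
proof -
  have "(\<lambda>(v, z). g z v) \<in> borel_measurable (borel \<Otimes>\<^sub>M Q)"
    unfolding split_def
    by (intro measurable_g_compose measurable_fst) (simp add: measurable_cong_sets[OF sets_pair_measure_cong[OF refl sets_Q] refl])
  from borel_measurable_lebesgue_integral[OF this] show ?thesis
    unfolding grad_H_def[abs_def] .
qed

lemma measurable_G: "G \<in> borel_measurable borel"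
proof -
  have "(\<lambda>(v, z). outer_square (g z v)) \<in> borel_measurable (borel \<Otimes>\<^sub>M Q)"
    unfolding split_def
    by (intro measurable_outer_square measurable_g_compose measurable_fst) (simp add: measurable_cong_sets[OF sets_pair_measure_cong[OF refl sets_Q] refl])
  from borel_measurable_lebesgue_integral[OF this] show ?thesis
    unfolding G_eps_def[abs_def] .
qed

lemma measurable_noise: "case_prod (noise n) \<in> borel_measurable (Pi\<^sub>M {..n} (\<lambda>_. borel) \<Otimes>\<^sub>M borel)"
proof -
  let ?N = "Pi\<^sub>M {..n} (\<lambda>_. borel :: (real ^ 'j) measure) \<Otimes>\<^sub>M (borel :: (real ^ 'j) measure)"
  have V: "(\<lambda>x. V (fst x) n) \<in> borel_measurable ?N" and S: "(\<lambda>x. S (fst x) n) \<in> borel_measurable ?N"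
    using measurable_V_S[of n n] by (auto intro: measurable_compose[OF measurable_fst])
  have z: "snd \<in> borel_measurable ?N" by (rule measurable_snd)
  note dH = measurable_compose[OF V measurable_grad_H]
  show ?thesis unfolding noise_def split_def
    by (intro borel_measurable_times borel_measurable_const borel_measurable_inner dH
        borel_measurable_matrix_inv_mult S S_invertible borel_measurable_diff measurable_g_compose[OF z V])
qed

lemma measurable_moment_noise:
  "case_prod (moment_noise i j n) \<in> borel_measurable (Pi\<^sub>M {..n} (\<lambda>_. borel) \<Otimes>\<^sub>M borel)"
proof -
  let ?N = "Pi\<^sub>M {..n} (\<lambda>_. borel :: (real ^ 'j) measure) \<Otimes>\<^sub>M (borel :: (real ^ 'j) measure)"
  have V: "(\<lambda>x. V (fst x) n) \<in> borel_measurable ?N"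
    using measurable_V_S[of n n] by (auto intro: measurable_compose[OF measurable_fst])
  have z: "snd \<in> borel_measurable ?N" by (rule measurable_snd)
  show ?thesis unfolding moment_noise_def split_def
    by (intro borel_measurable_divide borel_measurable_const borel_measurable_vec_nth borel_measurable_diff
        measurable_outer_square measurable_g_compose[OF z V] measurable_compose[OF V measurable_G])
qed

theorem almost_sure_convergence:
  fixes M :: "'a measure" and Y :: "nat \<Rightarrow> 'a \<Rightarrow> real ^ 'j"
  assumes M: "prob_space M"
    and indep: "prob_space.indep_vars M (\<lambda>_. borel) Y UNIV"
    and distr: "\<And>n. distr M borel (Y (Suc n)) = Q"
    and Y0: "\<And>\<omega>. \<omega> \<in> space M \<Longrightarrow> Y 0 \<omega> \<in> centered"
    and v0: "v0 \<in> centered" "\<And>u. u \<in> centered \<Longrightarrow> H v0 \<le> H u"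
  shows "AE \<omega> in M. V (\<lambda>k. Y k \<omega>) \<longlonglongrightarrow> v0"
    and "AE \<omega> in M. (\<lambda>n. (1 / real n) *\<^sub>R S (\<lambda>k. Y k \<omega>) n) \<longlonglongrightarrow> G v0"
proof -
  interpret M: prob_space M by (rule M)
  let ?p = "\<lambda>\<omega> k. Y k \<omega>"
  have noise_AE: "AE \<omega> in M. summable (\<lambda>n. noise n (?p \<omega>) (Y (Suc n) \<omega>))"
  proof -
    interpret D: bounded_martingale_differences M
      "\<lambda>n. vimage_algebra (space M) (\<lambda>\<omega>. restrict (?p \<omega>) {..n}) (Pi\<^sub>M {..n} (\<lambda>_. borel))"
      "\<lambda>n \<omega>. noise n (restrict (?p \<omega>) {..n}) (Y (Suc n) \<omega>)" "\<lambda>n. 8 * rate n"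
      by (rule M.martingale_differences_of_independent_sequence[OF indep])
         (auto simp: measurable_noise noise_bound distr noise_mean_zero)
    have "summable (\<lambda>n. (8 * rate n)\<^sup>2)"
      unfolding power_mult_distrib by (intro summable_mult summable_rate_squared)
    from D.AE_summable[OF this] show ?thesis by (simp only: noise_restrict)
  qed
  have moment_AE: "AE \<omega> in M. summable (\<lambda>n. moment_noise i j n (?p \<omega>) (Y (Suc n) \<omega>))" for i j
  proof -
    interpret D: bounded_martingale_differences M
      "\<lambda>n. vimage_algebra (space M) (\<lambda>\<omega>. restrict (?p \<omega>) {..n}) (Pi\<^sub>M {..n} (\<lambda>_. borel))"
      "\<lambda>n \<omega>. moment_noise i j n (restrict (?p \<omega>) {..n}) (Y (Suc n) \<omega>)" "\<lambda>n. 8 / real (Suc n)"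
      by (rule M.martingale_differences_of_independent_sequence[OF indep])
         (auto simp: measurable_moment_noise moment_noise_bound distr moment_noise_mean_zero simp del: of_nat_Suc)
    have "summable (\<lambda>n. inverse ((real (Suc n))\<^sup>2))"
      by (subst summable_Suc_iff[where f = "\<lambda>n. inverse ((real n)\<^sup>2)"]) (rule inverse_power_summable, simp)
    from summable_mult[OF this, of 64] have "summable (\<lambda>n. (8 / real (Suc n))\<^sup>2)"
      by (simp add: power_divide divide_inverse power_mult_distrib power_inverse del: of_nat_Suc)
    from D.AE_summable[OF this] show ?thesis by (simp only: moment_noise_restrict)
  qed
  show V: "AE \<omega> in M. V (?p \<omega>) \<longlonglongrightarrow> v0"
    using noise_AE AE_space
  proof eventually_elim
    case (elim \<omega>)
    show ?case by (rule V_converges[of "?p \<omega>", OF Y0[OF elim(2)] v0 elim(1)])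
  qed
  have "AE \<omega> in M. \<forall>i j. summable (\<lambda>n. moment_noise i j n (?p \<omega>) (Y (Suc n) \<omega>))"
    using moment_AE by (simp add: AE_all_countable)
  then show "AE \<omega> in M. (\<lambda>n. (1 / real n) *\<^sub>R S (?p \<omega>) n) \<longlonglongrightarrow> G v0"
    using V
  proof eventually_elim
    case (elim \<omega>)
    show ?case by (rule S_mean_converges[of "?p \<omega>", OF elim(2)]) (use elim(1) in blast)
  qed
qed

end

section \<open>Reduction to vectors of costs\<close>

text \<open>
  An independent sequence stays independent when a variable that is independent of the whole sequence
  is put in front of it: in a finite intersection, the events of the tail form one cylinder set.
\<close>
lemma (in prob_space) indep_vars_cons:
  fixes Y :: "nat \<Rightarrow> 'a \<Rightarrow> 'b"
  assumes Y0: "Y 0 \<in> measurable M N"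
    and tail: "indep_vars (\<lambda>_. N) Y {1..}"
    and indep: "\<And>A B. A \<in> sets N \<Longrightarrow> B \<in> sets (Pi\<^sub>M {1..} (\<lambda>_. N)) \<Longrightarrow>
      prob ((Y 0 -` A \<inter> space M) \<inter> ((\<lambda>\<omega>. \<lambda>n\<in>{1..}. Y n \<omega>) -` B \<inter> space M))
      = prob (Y 0 -` A \<inter> space M) * prob ((\<lambda>\<omega>. \<lambda>n\<in>{1..}. Y n \<omega>) -` B \<inter> space M)"
  shows "indep_vars (\<lambda>_. N) Y UNIV"
  unfolding indep_vars_def2
proof (intro conjI ballI indep_setsI)
  have Ym: "Y i \<in> measurable M N" for i
    using Y0 tail by (cases i) (auto simp: indep_vars_def)
  show "random_variable N (Y i)" for i by (rule Ym)
  show "{Y i -` A \<inter> space M |A. A \<in> sets N} \<subseteq> events" for i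
    using measurable_sets[OF Ym] by auto
  fix A J assume J: "J \<noteq> {}" "finite J" "\<forall>j\<in>J. A j \<in> {Y j -` A \<inter> space M |A. A \<in> sets N}"
  then obtain B where B: "\<And>j. j \<in> J \<Longrightarrow> B j \<in> sets N" "\<And>j. j \<in> J \<Longrightarrow> A j = Y j -` B j \<inter> space M"
    by (simp add: Ball_def) metis
  let ?K = "J - {0}"
  have "1 \<le> j" if "j \<in> ?K" for j using that by (cases j) auto
  then have K: "?K \<subseteq> {1..}" by auto
  have tailprod: "prob (\<Inter>j\<in>?K. A j) = (\<Prod>j\<in>?K. prob (A j))" if "?K \<noteq> {}"
    using tail K J B that unfolding indep_vars_def2
    by (intro indep_setsD[of "\<lambda>i. {Y i -` A \<inter> space M |A. A \<in> sets N}" "{1..}"]) auto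
  show "prob (\<Inter>j\<in>J. A j) = (\<Prod>j\<in>J. prob (A j))"
  proof (cases "0 \<in> J \<and> ?K \<noteq> {}")
    case False
    then consider "0 \<notin> J" | "J = {0}" using J(1) by auto
    then show ?thesis
    proof cases
      case 1
      then have "?K = J" by auto
      then show ?thesis using tailprod J(1) by simp
    qed simp
  next
    case True
    define C where "C = {u \<in> space (Pi\<^sub>M {1..} (\<lambda>_. N)). \<forall>j\<in>?K. u j \<in> B j}"
    have "{u \<in> space (Pi\<^sub>M {1..} (\<lambda>_. N)). u j \<in> B j} \<in> sets (Pi\<^sub>M {1..} (\<lambda>_. N))" if "j \<in> ?K" for j
      using that K B(1)[of j] by (intro sets_Collect_single') auto
    then have C: "C \<in> sets (Pi\<^sub>M {1..} (\<lambda>_. N))"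
      unfolding C_def using J(2) by (intro sets.sets_Collect_finite_All) auto
    have "(\<lambda>n\<in>{1..}. Y n \<omega>) \<in> C \<longleftrightarrow> (\<forall>j\<in>?K. Y j \<omega> \<in> B j)" if "\<omega> \<in> space M" for \<omega>
    proof -
      have "(\<lambda>n\<in>{1..}. Y n \<omega>) \<in> space (Pi\<^sub>M {1..} (\<lambda>_. N))"
        using measurable_space[OF Ym that] by (auto simp: space_PiM)
      moreover have "(\<lambda>n\<in>{1..}. Y n \<omega>) j = Y j \<omega>" if "j \<in> ?K" for j using K that by auto
      ultimately show ?thesis unfolding C_def by auto
    qed
    then have "(\<lambda>\<omega>. \<lambda>n\<in>{1..}. Y n \<omega>) -` C \<inter> space M = {\<omega> \<in> space M. \<forall>j\<in>?K. Y j \<omega> \<in> B j}"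
      unfolding set_eq_iff vimage_eq Int_iff mem_Collect_eq by metis
    also have "\<dots> = (\<Inter>j\<in>?K. A j)"
      using B(2) True by (auto 0 3)
    finally have "(\<lambda>\<omega>. \<lambda>n\<in>{1..}. Y n \<omega>) -` C \<inter> space M = (\<Inter>j\<in>?K. A j)" .
    moreover have "(\<Inter>j\<in>J. A j) = A 0 \<inter> (\<Inter>j\<in>?K. A j)" using True by blast
    moreover have "(\<Prod>j\<in>J. prob (A j)) = prob (A 0) * (\<Prod>j\<in>?K. prob (A j))"
      using True by (intro prod.remove J(2)) simp
    ultimately show ?thesis
      using indep[OF B(1)[of 0] C] B(2)[of 0] True tailprod by simp
  qed
qed

text \<open>
  If the gradient depends on \<open>x\<close> only through \<open>f x\<close>, so does the algorithm. The entry \<open>xs 0\<close> is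
  never read, which leaves room for the starting point in \<open>q 0\<close>.
\<close>
lemma sgn_reduce:
  fixes f :: "'x \<Rightarrow> 'z"
  assumes "\<And>k. q (Suc k) = f (xs (Suc k))"
  shows "sgn_V (\<lambda>x. g (f x)) w lab \<alpha> \<beta> \<gamma> v0 xs n = sgn_V g w lab \<alpha> \<beta> \<gamma> v0 q n \<and>
         sgn_S (\<lambda>x. g (f x)) w lab \<alpha> \<beta> \<gamma> v0 xs n = sgn_S g w lab \<alpha> \<beta> \<gamma> v0 q n"
  by (induction n) (simp_all add: assms)

lemma lower_semicontinuous_borel_measurable:
  fixes f :: "'a::topological_space \<Rightarrow> real"
  assumes "lower_semicontinuous f"
  shows "f \<in> borel_measurable borel"
proof (rule borel_measurableI_greater)
  fix t
  have "open {x. t < f x}"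
    using assms by (subst open_subopen) (fastforce simp: lower_semicontinuous_def eventually_nhds)
  then show "{x \<in> space borel. t < f x} \<in> sets borel" by simp
qed

lemma lower_semicontinuous_section:
  fixes c :: "'a::topological_space \<Rightarrow> 'b::topological_space \<Rightarrow> real"
  assumes "lower_semicontinuous (\<lambda>(x, y). c x y)"
  shows "lower_semicontinuous (\<lambda>x. c x y)"
  unfolding lower_semicontinuous_def
proof (intro allI impI)
  fix p t assume "t < c p y"
  then have "\<forall>\<^sub>F q in nhds (p, y). t < (case q of (x, y) \<Rightarrow> c x y)"
    using assms by (auto simp: lower_semicontinuous_def)
  moreover have "filterlim (\<lambda>x. (x, y)) (nhds (p, y)) (nhds p)"
    by (intro tendsto_Pair tendsto_const) (simp add: filterlim_ident)
  ultimately show "\<forall>\<^sub>F q in nhds p. t < c q y"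
    by (auto dest: filterlim_iff[THEN iffD1])
qed

theorem theorem3p1:
  fixes \<mu> :: "'x::metric_space measure"
    and \<nu> :: "'y::metric_space pmf"
    and y :: "'j::finite \<Rightarrow> 'y"
    and lab :: "nat \<Rightarrow> 'j"
    and c :: "'x \<Rightarrow> 'y \<Rightarrow> real"
    and cX :: "'x \<Rightarrow> real"
    and cY :: "'y \<Rightarrow> real"
    and \<epsilon> \<alpha> \<beta> \<gamma> :: real
    and w vstar :: "real ^ 'j"
    and M :: "'w measure"
    and X :: "nat \<Rightarrow> 'w \<Rightarrow> 'x"
    and V0 :: "'w \<Rightarrow> real ^ 'j"
    and V :: "nat \<Rightarrow> 'w \<Rightarrow> real ^ 'j"
    and S :: "nat \<Rightarrow> 'w \<Rightarrow> real ^ 'j ^ 'j"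
  assumes mu: "prob_space \<mu>" "sets \<mu> = sets borel"
    and nu: "inj y" "set_pmf \<nu> = range y"
    and w: "w = weight_vec \<nu> y"
    and lab: "bij_betw lab {1..CARD('j)} UNIV"
    and cost_lsc: "lower_semicontinuous (\<lambda>(x, y'). c x y')"
    and cost_bounds: "\<And>x y'. 0 \<le> c x y'" "\<And>x y'. c x y' \<le> cX x + cY y'"
    and cost_int: "integrable \<mu> cX" "integrable (measure_pmf \<nu>) cY"
    and eps: "\<epsilon> > 0"
    and ex_min: "\<exists>v. is_arg_min (H_eps \<mu> \<epsilon> c y w) (\<lambda>_. True) v"
    and vstar: "is_arg_min (H_eps \<mu> \<epsilon> c y w) (\<lambda>v. v \<in> centered) vstar"
    and G_pos: "min_rayleigh (G_eps \<mu> \<epsilon> c y w vstar) > 0"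
    and eps_le: "max_weight w \<noteq> min_weight w \<Longrightarrow>
                   \<epsilon> \<le> min_weight w / (max_weight w - min_weight w)"
    and M: "prob_space M"
    and X_indep: "prob_space.indep_vars M (\<lambda>_. borel) X {1..}"
    and X_distr: "\<And>n. n \<ge> 1 \<Longrightarrow> distr M borel (X n) = \<mu>"
    and beta: "0 < \<beta>" "\<beta> < 1/2"
    and gamma: "\<gamma> > 0"
    and V0: "V0 \<in> borel_measurable M" "integrable M (\<lambda>\<omega>. (norm (V0 \<omega>))\<^sup>2)"
            "\<And>\<omega>. \<omega> \<in> space M \<Longrightarrow> V0 \<omega> \<in> centered"
    and V0_indep: "prob_space.indep_set M
                     (sets (vimage_algebra (space M) V0 borel))
                     (sets (vimage_algebra (space M) (\<lambda>\<omega>. \<lambda>n\<in>{1..}. X n \<omega>) (Pi\<^sub>M {1..} (\<lambda>_. borel))))"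
    and V: "\<And>n \<omega>. V n \<omega> = sgn_V (grad_h \<epsilon> c y w) w lab \<alpha> \<beta> \<gamma> (V0 \<omega>) (\<lambda>k. X k \<omega>) n"
    and S: "\<And>n \<omega>. S n \<omega> = sgn_S (grad_h \<epsilon> c y w) w lab \<alpha> \<beta> \<gamma> (V0 \<omega>) (\<lambda>k. X k \<omega>) n"
    and alpha: "0 \<le> \<alpha>" "\<alpha> < 1/2"
    and alpha_beta: "\<alpha> + \<beta> < 1/2"
  shows "(AE \<omega> in M. (\<lambda>n. V n \<omega>) \<longlonglongrightarrow> vstar)
       \<and> (AE \<omega> in M. (\<lambda>n. (1 / real n) *\<^sub>R S n \<omega>) \<longlonglongrightarrow> G_eps \<mu> \<epsilon> c y w vstar)"
proof -
  define cost :: "'x \<Rightarrow> real ^ 'j" where "cost x = (\<chi> j. c x (y j))" for x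
  define Q where "Q = distr \<mu> borel cost"
  interpret mu: prob_space \<mu> by (rule mu(1))
  interpret M: prob_space M by (rule M)
  have w_pos: "0 < w $ j" for j
    using nu(2) by (auto simp: w weight_vec_def pmf_pos set_pmf_eq[symmetric] pmf_positive)
  have "(\<Sum>j\<in>UNIV. w $ j) = (\<Sum>j\<in>UNIV. pmf \<nu> (y j))" by (simp add: w weight_vec_def)
  also have "\<dots> = sum (pmf \<nu>) (range y)" using nu(1) by (simp add: sum.reindex)
  also have "\<dots> = 1" by (rule sum_pmf_eq_1) (use nu(2) in auto)
  finally have w_sum: "(\<Sum>j\<in>UNIV. w $ j) = 1" .
  have c_meas: "(\<lambda>x. c x (y j)) \<in> borel_measurable borel" for j
    by (rule lower_semicontinuous_borel_measurable[OF lower_semicontinuous_section[OF cost_lsc]])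
  have cost_borel: "cost \<in> borel_measurable borel"
    by (intro borel_measurable_vec) (simp add: cost_def c_meas)
  then have cost_mu: "cost \<in> borel_measurable \<mu>" by (simp add: measurable_cong_sets[OF mu(2) refl])
  have "integrable \<mu> (\<lambda>x. c x (y j))" for j
  proof (rule Bochner_Integration.integrable_bound)
    show "integrable \<mu> (\<lambda>x. cX x + cY (y j))" using cost_int(1) by simp
    show "(\<lambda>x. c x (y j)) \<in> borel_measurable \<mu>"
      using c_meas by (simp add: measurable_cong_sets[OF mu(2) refl])
    show "AE x in \<mu>. norm (c x (y j)) \<le> norm (cX x + cY (y j))"
      using cost_bounds by (intro AE_I2) (auto intro: order_trans[OF _ abs_ge_self])
  qed
  then have "integrable \<mu> (\<lambda>x. \<Sum>j\<in>UNIV. \<bar>c x (y j)\<bar>)" by auto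
  then have int_cost: "integrable \<mu> cost"
    by (rule Bochner_Integration.integrable_bound[OF _ cost_mu])
       (auto intro!: AE_I2 order_trans[OF norm_le_l1_cart] simp: cost_def sum_nonneg)
  have probQ: "prob_space Q" unfolding Q_def by (rule mu.prob_space_distr[OF cost_mu])
  interpret gauss_newton Q \<epsilon> w lab \<alpha> \<beta> \<gamma>
  proof -
    interpret Q: prob_space Q by (rule probQ)
    show "gauss_newton Q \<epsilon> w lab \<alpha> \<beta> \<gamma>"
    proof unfold_locales
      show "integrable Q (\<lambda>z. z)" unfolding Q_def using int_cost by (simp add: integrable_distr_eq[OF cost_mu])
    qed (use eps w_pos w_sum lab alpha beta gamma alpha_beta in \<open>auto simp: Q_def\<close>)
  qed
  have h_cost: "h_eps \<epsilon> c y w x v = h (cost x) v" for x v by (simp add: h_eps_def cost_def)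
  have g_cost: "grad_h \<epsilon> c y w x v = g (cost x) v" for x v by (simp add: grad_h_def pi_eps_def cost_def)
  have H_cost: "H_eps \<mu> \<epsilon> c y w v = H v" for v
    unfolding H_eps_def h_cost Q_def
    by (rule integral_distr[symmetric, OF cost_mu borel_measurable_continuous_onI[OF continuous_h]])
  have G_cost: "G_eps \<mu> \<epsilon> c y w v = G v" for v
    unfolding G_eps_def g_cost Q_def
    using outer_square_g_measurable[of v] by (intro integral_distr[symmetric, OF cost_mu]) (simp add: measurable_cong_sets[OF sets_Q refl])
  have min: "vstar \<in> centered" "\<And>u. u \<in> centered \<Longrightarrow> H vstar \<le> H u"
    using vstar by (auto simp: is_arg_min_def H_cost not_less)
  (* The path read by the locale gauss_newton: the starting point followed by the cost vectors. *)
  define Y where "Y k = (case k of 0 \<Rightarrow> V0 | Suc i \<Rightarrow> (\<lambda>\<omega>. cost (X (Suc i) \<omega>)))" for k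
  have Y0: "Y 0 = V0" and YS: "Y (Suc k) = (\<lambda>\<omega>. cost (X (Suc k) \<omega>))" for k by (simp_all add: Y_def)
  have X_meas: "X n \<in> measurable M borel" if "n \<ge> 1" for n
    using X_indep that by (auto simp: M.indep_vars_def)
  have tail: "M.indep_vars (\<lambda>_. borel) Y {1..}"
  proof -
    have "M.indep_vars (\<lambda>_. borel) (\<lambda>i \<omega>. cost (X i \<omega>)) {1..}"
      by (rule M.indep_vars_compose2[OF X_indep]) (rule cost_borel)
    then show ?thesis
      by (rule M.indep_vars_cong[THEN iffD1, rotated 3]) (auto simp: Y_def split: nat.split)
  qed
  have indep: "M.indep_vars (\<lambda>_. borel) Y UNIV"
  proof (rule M.indep_vars_cons[OF _ tail])
    show "Y 0 \<in> borel_measurable M" using V0(1) by (simp add: Y0)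
    fix A B assume A: "A \<in> sets (borel :: (real ^ 'j) measure)" and B: "B \<in> sets (Pi\<^sub>M {1::nat..} (\<lambda>_. borel :: (real ^ 'j) measure))"
    let ?X = "\<lambda>\<omega>. \<lambda>n\<in>{1..}. X n \<omega>" and ?c = "\<lambda>x. \<lambda>n\<in>{1..}. cost (x n)"
    have c: "?c \<in> measurable (Pi\<^sub>M {1..} (\<lambda>_. borel)) (Pi\<^sub>M {1..} (\<lambda>_. borel))"
      by (intro measurable_restrict measurable_compose[OF _ cost_borel] measurable_component_singleton)
    have Xs: "?X \<in> measurable M (Pi\<^sub>M {1..} (\<lambda>_. borel))"
      by (intro measurable_restrict) (simp add: X_meas)
    have "(\<lambda>\<omega>. \<lambda>n\<in>{1..}. Y n \<omega>) = (\<lambda>\<omega>. ?c (?X \<omega>))"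
      by (auto simp: fun_eq_iff Y_def restrict_def split: nat.split)
    then have "(\<lambda>\<omega>. \<lambda>n\<in>{1..}. Y n \<omega>) -` B \<inter> space M = ?X -` (?c -` B \<inter> space (Pi\<^sub>M {1..} (\<lambda>_. borel))) \<inter> space M"
      using measurable_space[OF Xs] by auto
    then have "(\<lambda>\<omega>. \<lambda>n\<in>{1..}. Y n \<omega>) -` B \<inter> space M \<in> sets (vimage_algebra (space M) ?X (Pi\<^sub>M {1..} (\<lambda>_. borel)))"
      using in_vimage_algebra[OF measurable_sets[OF c B]] by simp
    moreover have "Y 0 -` A \<inter> space M \<in> sets (vimage_algebra (space M) V0 borel)"
      unfolding Y0 by (rule in_vimage_algebra[OF A])
    ultimately show "M.prob ((Y 0 -` A \<inter> space M) \<inter> ((\<lambda>\<omega>. \<lambda>n\<in>{1..}. Y n \<omega>) -` B \<inter> space M))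
      = M.prob (Y 0 -` A \<inter> space M) * M.prob ((\<lambda>\<omega>. \<lambda>n\<in>{1..}. Y n \<omega>) -` B \<inter> space M)"
      by (intro M.indep_setD[OF V0_indep])
  qed
  have distr: "distr M borel (Y (Suc n)) = Q" for n
    using distr_distr[OF cost_borel X_meas[of "Suc n"]] X_distr[of "Suc n"] by (simp add: YS Q_def o_def)
  have path: "V n \<omega> = sgn_V g w lab \<alpha> \<beta> \<gamma> (Y 0 \<omega>) (\<lambda>k. Y k \<omega>) n"
    "S n \<omega> = sgn_S g w lab \<alpha> \<beta> \<gamma> (Y 0 \<omega>) (\<lambda>k. Y k \<omega>) n" for n \<omega>
    using sgn_reduce[of "\<lambda>k. Y k \<omega>" cost "\<lambda>k. X k \<omega>" g w lab \<alpha> \<beta> \<gamma> "V0 \<omega>" n]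
    by (simp_all add: V S Y0 YS g_cost[abs_def])
  show ?thesis
    using almost_sure_convergence[OF M indep distr _ min] V0(3)
    unfolding path G_cost by (simp add: Y0)
qed

end
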